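(* Let $(\mathcal{G},[\cdot,\cdot],\alpha)$ be a multiplicative Hom-Lie superalgebra over a field $\mathbb{K}$, let $(V,[\cdot,\cdot]_V,\beta)$ be a $\mathcal{G}$-Hom-module, and let $r\ge 1$ be an integer. Then the pair $\big(\bigoplus_{k>0}C^{k}_{\alpha,\beta}(\mathcal{G},V),\{\delta^{k}_{r}\}_{k>0}\big)$ is a cohomology complex, that is, $\delta^{k}_{r}\circ\delta^{k-1}_{r}=0$ on $C^{k-1}_{\alpha,\beta}(\mathcal{G},V)$.
   Context: All superspaces are $\mathbb{Z}_2$-graded vector spaces over $\mathbb{K}$; $|x|$ is the parity of a homogeneous element $x$. A Hom-Lie superalgebra is a triple $(\mathcal{G},[\cdot,\cdot],\alpha)$ with $\mathcal{G}=\mathcal{G}_0\oplus\mathcal{G}_1$ a superspace, $[\cdot,\cdot]:\mathcal{G}\times\mathcal{G}\to\mathcal{G}$ an even bilinear map and $\alpha:\mathcal{G}\to\mathcal{G}$ an even linear map such that for all homogeneous $x,y,z$: $[x,y]=-(-1)^{|x||y|}[y,x]$ and $(-1)^{|x||z|}[\alpha(x),[y,z]]+(-1)^{|z||y|}[\alpha(z),[x,y]]+(-1)^{|y||x|}[\alpha(y),[z,x]]=0$. It is multiplicative if $\alpha([x,y])=[\alpha(x),\alpha(y)]$ for all $x,y$. A $\mathcal{G}$-Hom-module is a triple $(V,[\cdot,\cdot]_V,\beta)$ with $V=V_0\oplus V_1$ a superspace, $\beta:V\to V$ an even linear map and $[\cdot,\cdot]_V:\mathcal{G}\times V\to V$ a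 bilinear map with $[\mathcal{G}_i,V_j]_V\subset V_{i+j}$, such that for homogeneous $x,y\in\mathcal{G}$, $v\in V$: $[\alpha(x),\beta(v)]_V=\beta([x,v]_V)$ and $[[x,y],\beta(v)]_V=[\alpha(x),[y,v]_V]_V-(-1)^{|x||y|}[\alpha(y),[x,v]_V]_V$. $C^k(\mathcal{G},V)$ is the space of $k$-linear maps $f:\mathcal{G}^{k}\to V$ with $f(\dots,x_i,x_{i+1},\dots)=-(-1)^{|x_i||x_{i+1}|}f(\dots,x_{i+1},x_i,\dots)$ for homogeneous arguments. A cochain $f$ is homogeneous of parity $|f|$ if $f(x_1,\dots,x_k)\in V_{|f|+|x_1|+\dots+|x_k|}$. The space of $k$-hom-cochains is $C^{k}_{\alpha,\beta}(\mathcal{G},V)=\{f\in C^k(\mathcal{G},V): \beta(f(x_1,\dots,x_k))=f(\alpha(x_1),\dots,\alpha(x_k))\}$. For homogeneous $f$ and homogeneous $x_0,\dots,x_k$ (and extended linearly), $$\delta^{k}_{r}(f)(x_0,\dots,x_k)=\sum_{0\le s<t\le k}(-1)^{t+|x_t|(|x_{s+1}|+\dots+|x_{t-1}|)}f\big(\alpha(x_0),\dots,\alpha(x_{s-1}),[x_s,x_t],\alpha(x_{s+1}),\dots,\widehat{x_t},\dots,\alpha(x_k)\big)$$ $$+\sum_{s=0}^{k}(-1)^{s+|x_s|(|f|+|x_0|+\dots+|x_{s-1}|)}\big[\alpha^{k+r-1}(x_s),f(x_0,\dots,\widehat{x_s},\dots,x_k)\big]_V,$$ where $\widehat{x_i}$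 means that $x_i$ is omitted. The map $\delta^k_r$ sends $C^{k}_{\alpha,\beta}(\mathcal{G},V)$ to $C^{k+1}_{\alpha,\beta}(\mathcal{G},V)$. *)

theory Defs
  imports Complex_Main "HOL-Library.Z2" "HOL-Library.Function_Algebras"
begin

text \<open>
  Parities are elements of the two-element field \<^typ>\<open>bit\<close>, so sums and products of parities are
  taken modulo 2; \<open>par_sign p\<close> is \<open>(-1)^p\<close>.
\<close>

definition par_sign :: "bit \<Rightarrow> 'k::comm_ring_1" where
  "par_sign p = (if p = 0 then 1 else -1)"

text \<open>
  The underlying vector space of a superspace is a whole type \<open>'a\<close> with scalar multiplication \<open>s\<close>;
  \<open>G 0\<close> and \<open>G 1\<close> are its even and odd subspaces.  \<open>x \<in> G p\<close> says that \<open>x\<close> is homogeneous of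
  parity \<open>p\<close>; the zero vector is homogeneous of both parities.
\<close>

locale superspace = vector_space s
  for s :: "'k::field \<Rightarrow> 'a::ab_group_add \<Rightarrow> 'a" +
  fixes G :: "bit \<Rightarrow> 'a set"
  assumes subspace_part: "subspace (G p)"
    and parts_span: "\<exists>y\<in>G 0. \<exists>z\<in>G 1. x = y + z"
    and parts_disjoint: "G 0 \<inter> G 1 = {0}"

definition proj :: "(bit \<Rightarrow> 'a::ab_group_add set) \<Rightarrow> bit \<Rightarrow> 'a \<Rightarrow> 'a" where
  "proj G p x = (THE y. y \<in> G p \<and> x - y \<in> G (p + 1))"

locale hom_lie_superalgebra = superspace sG G
  for sG :: "'k::field \<Rightarrow> 'g::ab_group_add \<Rightarrow> 'g" and G :: "bit \<Rightarrow> 'g set" +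
  fixes br :: "'g \<Rightarrow> 'g \<Rightarrow> 'g" and \<alpha> :: "'g \<Rightarrow> 'g"
  assumes br_linear_left: "Vector_Spaces.linear sG sG (\<lambda>x. br x y)"
    and br_linear_right: "Vector_Spaces.linear sG sG (br x)"
    and br_even: "x \<in> G p \<Longrightarrow> y \<in> G q \<Longrightarrow> br x y \<in> G (p + q)"
    and alpha_linear: "Vector_Spaces.linear sG sG \<alpha>"
    and alpha_even: "x \<in> G p \<Longrightarrow> \<alpha> x \<in> G p"
    and super_skew: "x \<in> G p \<Longrightarrow> y \<in> G q \<Longrightarrow> br x y = - sG (par_sign (p * q)) (br y x)"
    and hom_jacobi: "x \<in> G p \<Longrightarrow> y \<in> G q \<Longrightarrow> z \<in> G u \<Longrightarrow>
          sG (par_sign (p * u)) (br (\<alpha> x) (br y z))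
        + sG (par_sign (u * q)) (br (\<alpha> z) (br x y))
        + sG (par_sign (q * p)) (br (\<alpha> y) (br z x)) = 0"

locale multiplicative_hom_lie_superalgebra = hom_lie_superalgebra +
  assumes multiplicative: "\<alpha> (br x y) = br (\<alpha> x) (\<alpha> y)"

locale hom_module = hom_lie_superalgebra sG G br \<alpha> + V: superspace sV V
  for sG :: "'k::field \<Rightarrow> 'g::ab_group_add \<Rightarrow> 'g" and G :: "bit \<Rightarrow> 'g set"
    and br :: "'g \<Rightarrow> 'g \<Rightarrow> 'g" and \<alpha> :: "'g \<Rightarrow> 'g"
    and sV :: "'k \<Rightarrow> 'v::ab_group_add \<Rightarrow> 'v" and V :: "bit \<Rightarrow> 'v set" +
  fixes act :: "'g \<Rightarrow> 'v \<Rightarrow> 'v" and \<beta> :: "'v \<Rightarrow> 'v"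
  assumes act_linear_left: "Vector_Spaces.linear sG sV (\<lambda>x. act x v)"
    and act_linear_right: "Vector_Spaces.linear sV sV (act x)"
    and act_even: "x \<in> G p \<Longrightarrow> v \<in> V q \<Longrightarrow> act x v \<in> V (p + q)"
    and beta_linear: "Vector_Spaces.linear sV sV \<beta>"
    and beta_even: "v \<in> V p \<Longrightarrow> \<beta> v \<in> V p"
    and act_alpha_beta: "x \<in> G p \<Longrightarrow> v \<in> V q \<Longrightarrow> act (\<alpha> x) (\<beta> v) = \<beta> (act x v)"
    and act_br: "x \<in> G p \<Longrightarrow> y \<in> G q \<Longrightarrow> v \<in> V u \<Longrightarrow>
          act (br x y) (\<beta> v)
        = act (\<alpha> x) (act y v) - sV (par_sign (p * q)) (act (\<alpha> y) (act x v))"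

text \<open>
  A \<open>k\<close>-cochain is a function on lists that vanishes on lists of length other than \<open>k\<close>, so that it
  carries no data beyond a map on \<open>k\<close>-tuples.
\<close>

definition multilin ::
  "('k::field \<Rightarrow> 'g::ab_group_add \<Rightarrow> 'g) \<Rightarrow> ('k \<Rightarrow> 'v::ab_group_add \<Rightarrow> 'v) \<Rightarrow> nat \<Rightarrow> ('g list \<Rightarrow> 'v) \<Rightarrow> bool"
  where "multilin sG sV k f \<longleftrightarrow>
    (\<forall>xs i. length xs = k \<longrightarrow> i < k \<longrightarrow> Vector_Spaces.linear sG sV (\<lambda>y. f (xs[i := y])))"

definition cochains ::
  "('k::field \<Rightarrow> 'g::ab_group_add \<Rightarrow> 'g) \<Rightarrow> (bit \<Rightarrow> 'g set) \<Rightarrow> ('k \<Rightarrow> 'v::ab_group_add \<Rightarrow> 'v) \<Rightarrow> nat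
    \<Rightarrow> ('g list \<Rightarrow> 'v) set"
  where "cochains sG G sV k = {f.
    (\<forall>xs. length xs \<noteq> k \<longrightarrow> f xs = 0) \<and>
    multilin sG sV k f \<and>
    (\<forall>xs ps i. length xs = k \<longrightarrow> list_all2 (\<lambda>x p. x \<in> G p) xs ps \<longrightarrow> Suc i < k \<longrightarrow>
       f xs = - sV (par_sign (ps ! i * ps ! Suc i)) (f (xs[i := xs ! Suc i, Suc i := xs ! i])))}"

definition hom_cochains ::
  "('k::field \<Rightarrow> 'g::ab_group_add \<Rightarrow> 'g) \<Rightarrow> (bit \<Rightarrow> 'g set) \<Rightarrow> ('g \<Rightarrow> 'g)
    \<Rightarrow> ('k \<Rightarrow> 'v::ab_group_add \<Rightarrow> 'v) \<Rightarrow> ('v \<Rightarrow> 'v) \<Rightarrow> nat \<Rightarrow> ('g list \<Rightarrow> 'v) set"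
  where "hom_cochains sG G \<alpha> sV \<beta> k =
    {f \<in> cochains sG G sV k. \<forall>xs. length xs = k \<longrightarrow> \<beta> (f xs) = f (map \<alpha> xs)}"

definition cochain_parity ::
  "(bit \<Rightarrow> 'g set) \<Rightarrow> (bit \<Rightarrow> 'v set) \<Rightarrow> nat \<Rightarrow> bit \<Rightarrow> ('g list \<Rightarrow> 'v) \<Rightarrow> bool"
  where "cochain_parity G V k q f \<longleftrightarrow>
    (\<forall>xs ps. length xs = k \<longrightarrow> list_all2 (\<lambda>x p. x \<in> G p) xs ps \<longrightarrow> f xs \<in> V (q + sum_list ps))"

text \<open>The component of parity \<open>q\<close> of a multilinear map.\<close>

definition cochain_part ::
  "(bit \<Rightarrow> 'g::ab_group_add set) \<Rightarrow> (bit \<Rightarrow> 'v::ab_group_add set) \<Rightarrow> bit \<Rightarrow> ('g list \<Rightarrow> 'v) \<Rightarrow> 'g list \<Rightarrow> 'v"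
  where "cochain_part G V q f xs =
    (\<Sum>ps | length ps = length xs. proj V (q + sum_list ps) (f (map2 (proj G) ps xs)))"

definition omit :: "nat \<Rightarrow> 'a list \<Rightarrow> 'a list" where
  "omit i xs = take i xs @ drop (Suc i) xs"

text \<open>
  The coboundary formula for \<open>f\<close> homogeneous of parity \<open>q\<close> and arguments \<open>xs = [x\<^sub>0, \<dots>, x\<^sub>k]\<close>
  homogeneous of parities \<open>ps\<close>.
\<close>

definition delta_homogeneous ::
  "('k::field \<Rightarrow> 'v::ab_group_add \<Rightarrow> 'v) \<Rightarrow> ('g \<Rightarrow> 'g \<Rightarrow> 'g) \<Rightarrow> ('g \<Rightarrow> 'g) \<Rightarrow> ('g \<Rightarrow> 'v \<Rightarrow> 'v)
    \<Rightarrow> nat \<Rightarrow> nat \<Rightarrow> bit \<Rightarrow> ('g list \<Rightarrow> 'v) \<Rightarrow> bit list \<Rightarrow> 'g list \<Rightarrow> 'v"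
  where "delta_homogeneous sV br \<alpha> act r k q f ps xs =
    (\<Sum>t\<le>k. \<Sum>s<t. sV ((-1) ^ t * par_sign (ps ! t * (\<Sum>i\<in>{s<..<t}. ps ! i)))
       (f (omit t ((map \<alpha> xs)[s := br (xs ! s) (xs ! t)]))))
  + (\<Sum>s\<le>k. sV ((-1) ^ s * par_sign (ps ! s * (q + (\<Sum>i<s. ps ! i))))
       (act ((\<alpha> ^^ (k + r - 1)) (xs ! s)) (f (omit s xs))))"

text \<open>
  The linear extension of the formula: \<open>f\<close> and all the arguments are split into their homogeneous
  components.
\<close>

definition delta ::
  "(bit \<Rightarrow> 'g::ab_group_add set) \<Rightarrow> ('g \<Rightarrow> 'g \<Rightarrow> 'g) \<Rightarrow> ('g \<Rightarrow> 'g)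
    \<Rightarrow> ('k::field \<Rightarrow> 'v::ab_group_add \<Rightarrow> 'v) \<Rightarrow> (bit \<Rightarrow> 'v set) \<Rightarrow> ('g \<Rightarrow> 'v \<Rightarrow> 'v)
    \<Rightarrow> nat \<Rightarrow> nat \<Rightarrow> ('g list \<Rightarrow> 'v) \<Rightarrow> 'g list \<Rightarrow> 'v"
  where "delta G br \<alpha> sV V act r k f xs =
    (if length xs = k + 1 then
       \<Sum>q\<in>{0, 1}. \<Sum>ps | length ps = k + 1.
         delta_homogeneous sV br \<alpha> act r k q (cochain_part G V q f) ps (map2 (proj G) ps xs)
     else 0)"

text \<open>
  A cochain complex \<open>C 1 \<rightarrow> C 2 \<rightarrow> \<dots>\<close> indexed by \<open>k > 0\<close>, with \<open>d k\<close> defined on \<open>C k\<close>; the spaces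
  \<open>C k\<close> are subspaces of one ambient vector space.
\<close>

definition cohomology_complex ::
  "('k::field \<Rightarrow> 'c::ab_group_add \<Rightarrow> 'c) \<Rightarrow> (nat \<Rightarrow> 'c set) \<Rightarrow> (nat \<Rightarrow> 'c \<Rightarrow> 'c) \<Rightarrow> bool"
  where "cohomology_complex s C d \<longleftrightarrow>
    vector_space s \<and>
    (\<forall>k>0. module.subspace s (C k)) \<and>
    (\<forall>k>0. \<forall>f\<in>C k. d k f \<in> C (k + 1)) \<and>
    (\<forall>k>0. \<forall>f\<in>C k. \<forall>g\<in>C k. d k (f + g) = d k f + d k g) \<and>
    (\<forall>k>0. \<forall>c. \<forall>f\<in>C k. d k (s c f) = s c (d k f)) \<and>
    (\<forall>k>1. \<forall>f\<in>C (k - 1). d k (d (k - 1) f) = 0)"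


text \<open>
  Consistency of \<open>delta\<close> with the formula it extends: on a cochain of parity \<open>q\<close> and homogeneous
  arguments, the splitting into components has no effect.
\<close>

lemma bit_ne_iff: "(p::bit) \<noteq> p' \<longleftrightarrow> p' = p + 1"
  by (cases p; cases p') simp_all

context superspace
begin

lemma proj_eqI:
  assumes "y \<in> G p" "x - y \<in> G (p + 1)"
  shows "proj G p x = y"
  unfolding proj_def
proof (rule the_equality)
  show "y \<in> G p \<and> x - y \<in> G (p + 1)" using assms by simp
next
  fix z assume z: "z \<in> G p \<and> x - z \<in> G (p + 1)"
  have "z - y \<in> G p" using z assms subspace_diff subspace_part by blast
  moreover have "(x - y) - (x - z) \<in> G (p + 1)" using z assms subspace_diff subspace_part by blast
  then have "z - y \<in> G (p + 1)" by simp
  ultimately have "z - y \<in> G 0 \<inter> G 1" by (cases p) auto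
  then show "z = y" using parts_disjoint by auto
qed

lemma zero_part: "0 \<in> G p"
  using subspace_part subspace_0 by blast

lemma proj_homogeneous:
  assumes "x \<in> G p" shows "proj G p' x = (if p' = p then x else 0)"
proof (cases "p' = p")
  case True then show ?thesis using assms zero_part by (auto intro!: proj_eqI)
next
  case False
  then have "p = p' + 1" using bit_ne_iff by blast
  then show ?thesis using assms zero_part False by (auto intro!: proj_eqI)
qed

lemma map2_proj_homogeneous:
  assumes "list_all2 (\<lambda>x p. x \<in> G p) xs ps" "length ps' = length ps"
  shows "list_all2 (\<lambda>x p. x \<in> G p) (map2 (proj G) ps' xs) ps'"
    and "ps' = ps \<Longrightarrow> map2 (proj G) ps' xs = xs"
    and "ps' \<noteq> ps \<Longrightarrow> \<exists>j<length ps. map2 (proj G) ps' xs ! j = 0"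
proof -
  have len: "length xs = length ps" using assms(1) by (rule list_all2_lengthD)
  have nth: "map2 (proj G) ps' xs ! j = (if ps' ! j = ps ! j then xs ! j else 0)" if "j < length ps" for j
    using that assms len proj_homogeneous[OF list_all2_nthD[OF assms(1)]] by simp
  show "list_all2 (\<lambda>x p. x \<in> G p) (map2 (proj G) ps' xs) ps'"
    using assms len nth zero_part list_all2_nthD[OF assms(1)]
    by (auto simp: list_all2_conv_all_nth)
  show "ps' = ps \<Longrightarrow> map2 (proj G) ps' xs = xs"
    using len nth by (intro nth_equalityI) auto
  show "ps' \<noteq> ps \<Longrightarrow> \<exists>j<length ps. map2 (proj G) ps' xs ! j = 0"
    using assms(2) nth by (auto simp: list_eq_iff_nth_eq)
qed

end

lemma finite_bit_lists: "finite {ps::bit list. length ps = n}"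
proof -
  have "set ps \<subseteq> {0, 1}" for ps :: "bit list"
    using bit.exhaust by blast
  then have "{ps::bit list. length ps = n} = {ps. set ps \<subseteq> {0, 1} \<and> length ps = n}"
    by blast
  then show ?thesis by (simp add: finite_lists_length_eq)
qed

lemma multilin_zero:
  assumes "multilin sG sV k f" "length ys = k" "j < k" "ys ! j = 0"
  shows "f ys = 0"
proof -
  have "Vector_Spaces.linear sG sV (\<lambda>y. f (ys[j := y]))"
    using assms unfolding multilin_def by blast
  then interpret l: Vector_Spaces.linear sG sV "\<lambda>y. f (ys[j := y])" .
  show ?thesis using l.zero assms(4) by (metis list_update_id)
qed

lemma length_omit: "i < length xs \<Longrightarrow> length (omit i xs) = length xs - 1"
  unfolding omit_def by auto

lemma list_all2_omit: "list_all2 P xs ps \<Longrightarrow> list_all2 P (omit i xs) (omit i ps)"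
  unfolding omit_def by (intro list_all2_appendI list_all2_takeI list_all2_dropI)

lemma nth_omit: "i < length xs \<Longrightarrow> j < length xs - 1 \<Longrightarrow> omit i xs ! j = (if j < i then xs ! j else xs ! Suc j)"
  unfolding omit_def by (auto simp: nth_append min_def)

lemma omit_has: "j < length xs \<Longrightarrow> i < length xs \<Longrightarrow> j \<noteq> i \<Longrightarrow> \<exists>m < length xs - 1. omit i xs ! m = xs ! j"
  by (cases "j < i") (auto intro!: exI[of _ "if j < i then j else j - 1"] simp: nth_omit)

context hom_module
begin

lemma cochain_part_homogeneous:
  assumes f: "multilin sG sV k f" "cochain_parity G V k q f"
    and ys: "length ys = k" "list_all2 (\<lambda>x p. x \<in> G p) ys ps"
  shows "cochain_part G V q' f ys = (if q' = q then f ys else 0)"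
proof -
  have len: "length ps = k" using ys list_all2_lengthD by metis
  have "f ys \<in> V (q + sum_list ps)" using f ys unfolding cochain_parity_def by blast
  then have main: "proj V (q' + sum_list ps) (f ys) = (if q' = q then f ys else 0)"
    using V.proj_homogeneous by (simp only: add_right_cancel)
  have V0: "proj V p 0 = 0" for p
    using V.proj_homogeneous[OF V.zero_part] by auto
  have "proj V (q' + sum_list ps') (f (map2 (proj G) ps' ys)) = (if ps' = ps then proj V (q' + sum_list ps) (f ys) else 0)"
    if l: "length ps' = k" for ps'
  proof (cases "ps' = ps")
    case True then show ?thesis using map2_proj_homogeneous(2)[OF ys(2)] by simp
  next
    case False
    then obtain j where "j < k" "map2 (proj G) ps' ys ! j = 0"
      using map2_proj_homogeneous(3)[OF ys(2), of ps'] l len by auto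
    then have "f (map2 (proj G) ps' ys) = 0"
      using l ys by (intro multilin_zero[OF f(1)]) auto
    then show ?thesis using False V0 by simp
  qed
  then have "cochain_part G V q' f ys =
      (\<Sum>ps' | length ps' = k. if ps' = ps then proj V (q' + sum_list ps) (f ys) else 0)"
    unfolding cochain_part_def using ys(1) by (intro sum.cong) auto
  also have "\<dots> = proj V (q' + sum_list ps) (f ys)"
    using finite_bit_lists len by (subst sum.delta) auto
  finally show ?thesis using main by simp
qed

lemma delta_homogeneous_cochain_part:
  assumes f: "multilin sG sV k f" "cochain_parity G V k q f"
    and ys: "length ys = k + 1" "list_all2 (\<lambda>x p. x \<in> G p) ys ps"
  shows "delta_homogeneous sV br \<alpha> act r k q' (cochain_part G V q' f) ps ys =
    (if q' = q then delta_homogeneous sV br \<alpha> act r k q f ps ys else 0)"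
proof -
  have len: "length ps = k + 1" using ys list_all2_lengthD by metis
  have hom: "ys ! i \<in> G (ps ! i)" if "i \<le> k" for i
    using list_all2_nthD[OF ys(2)] that ys(1) by simp
  have 1: "cochain_part G V q' f (omit t ((map \<alpha> ys)[s := br (ys ! s) (ys ! t)])) =
      (if q' = q then f (omit t ((map \<alpha> ys)[s := br (ys ! s) (ys ! t)])) else 0)"
    if "t \<le> k" "s < t" for s t
  proof (rule cochain_part_homogeneous[OF f])
    show "length (omit t ((map \<alpha> ys)[s := br (ys ! s) (ys ! t)])) = k"
      using that ys by (simp add: length_omit)
    show "list_all2 (\<lambda>x p. x \<in> G p) (omit t ((map \<alpha> ys)[s := br (ys ! s) (ys ! t)]))
        (omit t (ps[s := ps ! s + ps ! t]))"
    proof (intro list_all2_omit list_all2_all_nthI)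
      fix i assume "i < length ((map \<alpha> ys)[s := br (ys ! s) (ys ! t)])"
      then have i: "i \<le> k" using ys(1) by simp
      show "(map \<alpha> ys)[s := br (ys ! s) (ys ! t)] ! i \<in> G (ps[s := ps ! s + ps ! t] ! i)"
      proof (cases "i = s")
        case True
        have "br (ys ! s) (ys ! t) \<in> G (ps ! s + ps ! t)" using that by (intro br_even hom) auto
        then show ?thesis using True i ys(1) len by (simp del: plus_bit_def)
      next
        case False
        then show ?thesis using alpha_even[OF hom[OF i]] i ys(1) by simp
      qed
    qed (use ys len in simp)
  qed
  have 2: "cochain_part G V q' f (omit s ys) = (if q' = q then f (omit s ys) else 0)" if "s \<le> k" for s
    using that ys by (intro cochain_part_homogeneous[OF f]) (auto simp: length_omit intro: list_all2_omit)
  have act0: "act x 0 = 0" for x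
  proof -
    interpret l: Vector_Spaces.linear sV sV "act x" by (rule act_linear_right)
    show ?thesis by (rule l.zero)
  qed
  show ?thesis
    unfolding delta_homogeneous_def by (auto simp: 1 2 act0 intro!: sum.neutral)
qed

lemma delta_homogeneous_zero:
  assumes f: "multilin sG sV k f" and ys: "length ys = k + 1" "j \<le> k" "ys ! j = 0"
  shows "delta_homogeneous sV br \<alpha> act r k q f ps ys = 0"
proof -
  interpret a: Vector_Spaces.linear sG sG \<alpha> by (rule alpha_linear)
  have alpha0: "\<alpha> 0 = 0" by (rule a.zero)
  then have alphan: "(\<alpha> ^^ n) 0 = 0" for n by (induction n) auto
  have br0: "br 0 x = 0" "br x 0 = 0" for x
    using module_hom.zero[OF Vector_Spaces.linear.axioms(3)[OF br_linear_left]]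
      module_hom.zero[OF Vector_Spaces.linear.axioms(3)[OF br_linear_right]] by auto
  have act0: "act 0 v = 0" "act x 0 = 0" for x v
    using module_hom.zero[OF Vector_Spaces.linear.axioms(3)[OF act_linear_left]]
      module_hom.zero[OF Vector_Spaces.linear.axioms(3)[OF act_linear_right]] by auto
  have 1: "f (omit t ((map \<alpha> ys)[s := br (ys ! s) (ys ! t)])) = 0" if st: "t \<le> k" "s < t" for s t
  proof -
    let ?zs = "(map \<alpha> ys)[s := br (ys ! s) (ys ! t)]"
    define i where "i = (if j = t then s else j)"
    have "?zs ! i = 0" "i \<noteq> t" "i \<le> k"
      using st ys alpha0 br0 by (auto simp: i_def nth_list_update)
    moreover obtain m where "m < k" "omit t ?zs ! m = ?zs ! i"
      using omit_has[of i ?zs t] calculation st ys by auto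
    ultimately show ?thesis
      using st ys by (intro multilin_zero[OF f, where j = m]) (auto simp: length_omit)
  qed
  have 2: "act ((\<alpha> ^^ n) (ys ! s)) (f (omit s ys)) = 0" if s: "s \<le> k" for s n
  proof (cases "s = j")
    case True then show ?thesis using ys alphan act0 by simp
  next
    case False
    then obtain m where "m < k" "omit s ys ! m = ys ! j"
      using omit_has[of j ys s] s ys by auto
    then have "f (omit s ys) = 0"
      using s ys by (intro multilin_zero[OF f, where j = m]) (auto simp: length_omit)
    then show ?thesis using act0 by simp
  qed
  show ?thesis unfolding delta_homogeneous_def by (simp add: 1 2)
qed

lemma delta_eq_delta_homogeneous:
  assumes f: "f \<in> cochains sG G sV k" "cochain_parity G V k q f"
    and xs: "length xs = k + 1" "list_all2 (\<lambda>x p. x \<in> G p) xs ps"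
  shows "delta G br \<alpha> sV V act r k f xs = delta_homogeneous sV br \<alpha> act r k q f ps xs"
proof -
  have ml: "multilin sG sV k f" using f unfolding cochains_def by blast
  have len: "length ps = k + 1" using xs list_all2_lengthD by metis
  have summand: "delta_homogeneous sV br \<alpha> act r k q' (cochain_part G V q' f) ps' (map2 (proj G) ps' xs) =
      (if ps' = ps then if q' = q then delta_homogeneous sV br \<alpha> act r k q f ps xs else 0 else 0)"
    if l: "length ps' = k + 1" for q' ps'
  proof -
    have l': "length ps' = length ps" using l len by simp
    have "length (map2 (proj G) ps' xs) = k + 1" using l xs by simp
    then have eq: "delta_homogeneous sV br \<alpha> act r k q' (cochain_part G V q' f) ps' (map2 (proj G) ps' xs) =
      (if q' = q then delta_homogeneous sV br \<alpha> act r k q f ps' (map2 (proj G) ps' xs) else 0)"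
      by (rule delta_homogeneous_cochain_part[OF ml f(2) _ map2_proj_homogeneous(1)[OF xs(2) l']])
    show ?thesis
    proof (cases "ps' = ps")
      case True then show ?thesis using eq map2_proj_homogeneous(2)[OF xs(2) l'] by simp
    next
      case False
      then have "\<exists>j<length ps. map2 (proj G) ps' xs ! j = 0"
        by (rule map2_proj_homogeneous(3)[OF xs(2) l'])
      then obtain j where "j < k + 1" "map2 (proj G) ps' xs ! j = 0"
        unfolding len by blast
      then have "delta_homogeneous sV br \<alpha> act r k q f ps' (map2 (proj G) ps' xs) = 0"
        using l xs by (intro delta_homogeneous_zero[OF ml, where j = j]) auto
      then show ?thesis using eq False by simp
    qed
  qed
  have "delta G br \<alpha> sV V act r k f xs =
      (\<Sum>q'\<in>{0, 1}. \<Sum>ps' | length ps' = k + 1.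
        if ps' = ps then if q' = q then delta_homogeneous sV br \<alpha> act r k q f ps xs else 0 else 0)"
    unfolding delta_def using xs(1) summand by (auto intro!: sum.cong)
  also have "\<dots> = (\<Sum>q'\<in>{0, 1}. if q' = q then delta_homogeneous sV br \<alpha> act r k q f ps xs else 0)"
    using finite_bit_lists len by (intro sum.cong refl) (subst sum.delta, auto)
  also have "\<dots> = delta_homogeneous sV br \<alpha> act r k q f ps xs"
    by (cases q) auto
  finally show ?thesis .
qed

end

end

theory Submission
  imports Defs
begin

text \<open>
  No symmetry of the cochain is needed for \<open>\<delta> \<circ> \<delta> = 0\<close>: every bracket \<open>[x\<^sub>s, x\<^sub>t]\<close> stays in position
  \<open>s\<close>, so each last argument \<open>x\<close> acts as a super derivation \<open>R\<^sub>x\<close> on the arguments before it.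
  Up to a global sign the bracket part \<open>B\<close> and the action part \<open>A\<close> of \<open>\<delta>\<close> are then given by
  \<open>(B f)(\<dots>, x) = R\<^sub>x f - B (f(\<dots>, \<alpha> x))\<close> and \<open>(A f)(\<dots>, x) = [\<alpha>\<^sup>n x, f] - A (f(\<dots>, x))\<close>.
  The Hom-Jacobi identity says that \<open>x \<mapsto> R\<^sub>x\<close> is a (twisted) representation; this gives
  \<open>R\<^bsub>x\<^esub> B = B R\<^bsub>\<alpha> x\<^esub>\<close>, hence \<open>B B = 0\<close> by induction on the arity.
  In the same way the module axiom gives \<open>A A + A B + B A = 0\<close>; for the induction the two
  functions \<open>f(\<dots>, x)\<close> and \<open>f(\<dots>, \<alpha> x)\<close> have to be carried along together.
\<close>

section \<open>Parities, signs and homogeneous components\<close>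

text \<open>Parities stay sums and products in a commutative ring, so that distributivity and
  \<open>ac_simps\<close> can normalise the exponents of signs.\<close>

declare add_bit_eq_xor [simp del] mult_bit_eq_and [simp del]

lemma par_sign_add: "par_sign (p + q) = par_sign p * par_sign q"
  by (cases p; cases q) (simp_all add: par_sign_def)

lemma par_sign_zero [simp]: "par_sign 0 = 1"
  by (simp add: par_sign_def)

lemma par_sign_square [simp]:
  "par_sign p * par_sign p = 1" "par_sign p * (par_sign p * c) = c"
  by (simp_all add: par_sign_def)

context superspace
begin

text \<open>Existence for the definite description in \<open>proj\<close>, complementing the
  uniqueness in \<open>proj_eqI\<close>; the even and odd summands of \<open>x\<close> are the
  witnesses.\<close>

lemma proj_props: "proj G p x \<in> G p \<and> x - proj G p x \<in> G (p + 1)"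
proof -
  obtain y z where yz: "y \<in> G 0" "z \<in> G 1" "x = y + z" using parts_span by blast
  have "\<exists>w. w \<in> G p \<and> x - w \<in> G (p + 1)"
    by (cases p) (use yz in \<open>auto intro: exI[of _ y] exI[of _ z]\<close>)
  then show ?thesis using proj_eqI by metis
qed

lemma proj_add: "proj G p (x + y) = proj G p x + proj G p y"
proof (rule proj_eqI)
  show "proj G p x + proj G p y \<in> G p"
    using proj_props subspace_part by (blast intro: subspace_add)
  have "(x - proj G p x) + (y - proj G p y) \<in> G (p + 1)"
    using proj_props subspace_part by (blast intro: subspace_add)
  then show "x + y - (proj G p x + proj G p y) \<in> G (p + 1)" by (simp add: algebra_simps)
qed

lemma proj_scale: "proj G p (s c x) = s c (proj G p x)"
proof (rule proj_eqI)
  show "s c (proj G p x) \<in> G p"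
    using proj_props subspace_part by (blast intro: subspace_scale)
  have "s c (x - proj G p x) \<in> G (p + 1)"
    using proj_props subspace_part by (blast intro: subspace_scale)
  then show "s c x - s c (proj G p x) \<in> G (p + 1)" by (simp add: scale_right_diff_distrib)
qed

lemma proj_zero: "proj G p 0 = 0"
  using proj_scale[of p 0 0] by simp

lemma proj_sum: "proj G p x + proj G (p + 1) x = x"
proof -
  have "proj G (p + 1) x = x - proj G p x"
  proof (rule proj_eqI)
    show "x - proj G p x \<in> G (p + 1)" using proj_props by blast
    have "p + 1 + 1 = p" by (cases p) simp_all
    then show "x - (x - proj G p x) \<in> G (p + 1 + 1)" using proj_props by simp
  qed
  then show ?thesis by simp
qed

end

section \<open>The coboundary by recursion on the last argument\<close>

locale multiplicative_hom_module =
  multiplicative_hom_lie_superalgebra sG G br \<alpha> + hom_module sG G br \<alpha> sV V act \<beta>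
  for sG :: "'k::field \<Rightarrow> 'g::ab_group_add \<Rightarrow> 'g" and G :: "bit \<Rightarrow> 'g set"
    and br :: "'g \<Rightarrow> 'g \<Rightarrow> 'g" and \<alpha> :: "'g \<Rightarrow> 'g"
    and sV :: "'k \<Rightarrow> 'v::ab_group_add \<Rightarrow> 'v" and V :: "bit \<Rightarrow> 'v set"
    and act :: "'g \<Rightarrow> 'v \<Rightarrow> 'v" and \<beta> :: "'v \<Rightarrow> 'v"
begin

lemma alpha_simps: "\<alpha> (x + y) = \<alpha> x + \<alpha> y" "\<alpha> (sG c x) = sG c (\<alpha> x)" "\<alpha> 0 = 0"
  using alpha_linear module_hom.zero[OF Vector_Spaces.linear.axioms(3)[OF alpha_linear]]
  by (simp_all add: Vector_Spaces.linear_iff)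

lemma funpow_alpha_simps:
  "(\<alpha> ^^ n) (x + y) = (\<alpha> ^^ n) x + (\<alpha> ^^ n) y" "(\<alpha> ^^ n) (sG c x) = sG c ((\<alpha> ^^ n) x)"
  by (induction n) (simp_all add: alpha_simps)

lemma funpow_alpha_even: "x \<in> G p \<Longrightarrow> (\<alpha> ^^ n) x \<in> G p"
  by (induction n) (simp_all add: alpha_even)

lemma funpow_alpha_br: "(\<alpha> ^^ n) (br x y) = br ((\<alpha> ^^ n) x) ((\<alpha> ^^ n) y)"
  by (induction n) (simp_all add: multiplicative)

lemma br_simps:
  "br (x + x') y = br x y + br x' y" "br (sG c x) y = sG c (br x y)"
  "br x (y + y') = br x y + br x y'" "br x (sG c y) = sG c (br x y)"
  using br_linear_left br_linear_right by (simp_all add: Vector_Spaces.linear_iff)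

lemma act_simps:
  "act (x + x') v = act x v + act x' v" "act (sG c x) v = sV c (act x v)"
  "act x (v + v') = act x v + act x v'" "act x (sV c v) = sV c (act x v)"
  "act x (- v) = - act x v" "act x (v - v') = act x v - act x v'" "act x 0 = 0"
proof -
  interpret l: Vector_Spaces.linear sV sV "act x" by (rule act_linear_right)
  show "act x (v + v') = act x v + act x v'" "act x (sV c v) = sV c (act x v)"
    "act x (- v) = - act x v" "act x (v - v') = act x v - act x v'" "act x 0 = 0"
    by (rule l.add l.scale l.neg l.diff l.zero)+
  show "act (x + x') v = act x v + act x' v" "act (sG c x) v = sV c (act x v)"
    using act_linear_left by (simp_all add: Vector_Spaces.linear_iff)
qed

lemma beta_simps:
  "\<beta> (v + v') = \<beta> v + \<beta> v'" "\<beta> (sV c v) = sV c (\<beta> v)"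
  "\<beta> (- v) = - \<beta> v" "\<beta> (v - v') = \<beta> v - \<beta> v'" "\<beta> 0 = 0"
proof -
  interpret l: Vector_Spaces.linear sV sV \<beta> by (rule beta_linear)
  show "\<beta> (v + v') = \<beta> v + \<beta> v'" "\<beta> (sV c v) = sV c (\<beta> v)"
    "\<beta> (- v) = - \<beta> v" "\<beta> (v - v') = \<beta> v - \<beta> v'" "\<beta> 0 = 0"
    by (rule l.add l.scale l.neg l.diff l.zero)+
qed

text \<open>Both sides are additive in \<open>v\<close>, so the axiom passes from homogeneous
  vectors to all; likewise for \<open>act_br'\<close>. The operators below act on values about whose
  parity nothing is assumed.\<close>

lemma act_alpha_beta':
  assumes "x \<in> G p" shows "act (\<alpha> x) (\<beta> v) = \<beta> (act x v)"
proof -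
  obtain y z where "y \<in> V 0" "z \<in> V 1" "v = y + z" using V.parts_span by blast
  then show ?thesis using act_alpha_beta[OF assms] by (simp add: beta_simps act_simps)
qed

lemma act_br':
  assumes "x \<in> G p" "y \<in> G q"
  shows "act (br x y) (\<beta> v) = act (\<alpha> x) (act y v) - sV (par_sign (p * q)) (act (\<alpha> y) (act x v))"
proof -
  obtain a b where "a \<in> V 0" "b \<in> V 1" "v = a + b" using V.parts_span by blast
  then show ?thesis using act_br[OF assms]
    by (simp add: beta_simps act_simps V.scale_right_distrib algebra_simps)
qed

text \<open>Leibniz form of the Hom-Jacobi identity: bracketing with \<open>z\<close> from the right
  is a twisted super derivation. The cyclic form is multiplied by \<open>par_sign (p * u)\<close>,
  and super skew-symmetry turns round the brackets that stand in the wrong order.\<close>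

lemma jacobi_right:
  assumes "x \<in> G p" "y \<in> G q" "z \<in> G u"
  shows "br (br x y) (\<alpha> z) = br (\<alpha> x) (br y z) + sG (par_sign (q * u)) (br (br x z) (\<alpha> y))"
proof -
  have *: "br (\<alpha> z) (br x y) = - sG (par_sign (u * (p + q))) (br (br x y) (\<alpha> z))"
    using super_skew[OF alpha_even[OF assms(3)] br_even[OF assms(1,2)]] .
  have 1: "br z x = - sG (par_sign (u * p)) (br x z)" using super_skew assms by blast
  have 2: "br (\<alpha> y) (br x z) = - sG (par_sign (q * (p + u))) (br (br x z) (\<alpha> y))"
    using super_skew[OF alpha_even[OF assms(2)] br_even[OF assms(1,3)]] .
  have neg: "br x (- y) = - br x y" for x y
    using module_hom.neg[OF Vector_Spaces.linear.axioms(3)[OF br_linear_right]] .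
  have "sG (par_sign (p * u)) (sG (par_sign (p * u)) (br (\<alpha> x) (br y z))
        + sG (par_sign (u * q)) (br (\<alpha> z) (br x y))
        + sG (par_sign (q * p)) (br (\<alpha> y) (br z x))) = 0"
    unfolding hom_jacobi[OF assms] by simp
  then show ?thesis unfolding * 1 neg br_simps 2
    by (simp add: scale_right_distrib scale_right_diff_distrib scale_minus_right par_sign_add distrib_left distrib_right ac_simps
      add_eq_0_iff2)
qed

text \<open>
  Arguments carry their parity and are listed in reverse order, so that the head of a list is the
  last argument.
\<close>

definition tw :: "bit \<times> 'g \<Rightarrow> bit \<times> 'g" where
  "tw z = (fst z, \<alpha> (snd z))"

definition bk :: "bit \<times> 'g \<Rightarrow> bit \<times> 'g \<Rightarrow> bit \<times> 'g" where
  "bk w z = (fst w + fst z, br (snd w) (snd z))"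

definition sg :: "bit \<times> 'g \<Rightarrow> bit \<times> 'g \<Rightarrow> 'k" where
  "sg w z = par_sign (fst w * fst z)"

abbreviation par :: "(bit \<times> 'g) list \<Rightarrow> bit" where
  "par zs \<equiv> sum_list (map fst zs)"

text \<open>The derivation \<open>R\<^sub>z\<close>. The element \<open>z\<close> comes in from the
  right: it meets the last argument without a sign and picks up a Koszul sign for each argument it
  passes on the way to an earlier one.\<close>

primrec der :: "bit \<times> 'g \<Rightarrow> ((bit \<times> 'g) list \<Rightarrow> 'v) \<Rightarrow> (bit \<times> 'g) list \<Rightarrow> 'v" where
  "der z F [] = 0"
| "der z F (w # zs) = F (bk w z # map tw zs) + sV (sg z w) (der z (\<lambda>ys. F (tw w # ys)) zs)"

text \<open>The bracket part \<open>B\<close>, normalised so that the terms moving the last argument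
  have no sign besides the Koszul sign.\<close>

primrec dbr :: "((bit \<times> 'g) list \<Rightarrow> 'v) \<Rightarrow> (bit \<times> 'g) list \<Rightarrow> 'v" where
  "dbr F [] = 0"
| "dbr F (z # zs) = der z F zs - dbr (\<lambda>ys. F (tw z # ys)) zs"

text \<open>Here \<open>zs\<close> are the arguments in front of \<open>z\<close>, and
  \<open>n\<close> will be \<open>k + r - 1\<close>.\<close>

definition ract :: "nat \<Rightarrow> bit \<Rightarrow> bit \<times> 'g \<Rightarrow> ((bit \<times> 'g) list \<Rightarrow> 'v) \<Rightarrow> (bit \<times> 'g) list \<Rightarrow> 'v" where
  "ract n q z F zs = sV (par_sign (fst z * (q + par zs))) (act ((\<alpha> ^^ n) (snd z)) (F zs))"

text \<open>The action part \<open>A\<close>. When \<open>z\<close> is fixed, \<open>q\<close> stays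
  the parity of the whole cochain: the sign of an acting argument counts only the cochain and the
  arguments before it, and \<open>z\<close> comes after.\<close>

primrec dact :: "nat \<Rightarrow> bit \<Rightarrow> ((bit \<times> 'g) list \<Rightarrow> 'v) \<Rightarrow> (bit \<times> 'g) list \<Rightarrow> 'v" where
  "dact n q F [] = 0"
| "dact n q F (z # zs) = ract n q z F zs - dact n q (\<lambda>ys. F (z # ys)) zs"

abbreviation homog :: "bit \<times> 'g \<Rightarrow> bool" where
  "homog z \<equiv> snd z \<in> G (fst z)"

text \<open>The labels are fixed while the vectors vary, with no condition of homogeneity or length;
  so the property survives fixing the head of the list.\<close>

definition mlin :: "((bit \<times> 'g) list \<Rightarrow> 'v) \<Rightarrow> bool" where
  "mlin F \<longleftrightarrow> (\<forall>ys p x y zs. F (ys @ (p, x + y) # zs) = F (ys @ (p, x) # zs) + F (ys @ (p, y) # zs)) \<and>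
    (\<forall>ys p c x zs. F (ys @ (p, sG c x) # zs) = sV c (F (ys @ (p, x) # zs)))"

lemma tw_simps [simp]: "fst (tw z) = fst z" "snd (tw z) = \<alpha> (snd z)" "fst \<circ> tw = fst"
  by (auto simp: tw_def)

lemma sg_simps [simp]: "sg (tw w) z = sg w z" "sg w (tw z) = sg w z"
  by (auto simp: sg_def)

lemma tw_bk: "tw (bk w z) = bk (tw w) (tw z)"
  by (simp add: tw_def bk_def multiplicative)

lemma sg_bk: "sg (bk w z) y = sg w y * sg z y" "sg y (bk w z) = sg y w * sg y z"
  by (simp_all add: sg_def bk_def par_sign_add distrib_left distrib_right)

lemma sg_commute: "sg w z = sg z w"
  by (simp add: sg_def mult.commute)

lemma sg_square [simp]: "sg z w * sg z w = 1" "sg z w * (sg z w * c) = c"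
  by (simp_all add: sg_def)

lemma homog_bk: "homog w \<Longrightarrow> homog z \<Longrightarrow> homog (bk w z)"
  by (simp add: bk_def br_even)

lemma mlin_Cons: "mlin F \<Longrightarrow> mlin (\<lambda>ys. F (z # ys))"
  unfolding mlin_def by (metis append_Cons)

lemma mlin_head:
  assumes "mlin F"
  shows "F ((p, x + y) # zs) = F ((p, x) # zs) + F ((p, y) # zs)"
    "F ((p, sG c x) # zs) = sV c (F ((p, x) # zs))"
  using assms unfolding mlin_def by (metis append_Nil)+

section \<open>Linearity of the operators in the cochain, and commutation with the action\<close>

lemmas V_simps = V.scale_right_distrib V.scale_right_diff_distrib V.scale_minus_right V.scale_scale

lemma der_linear:
  "der z (\<lambda>ys. F ys + F' ys) zs = der z F zs + der z F' zs"
  "der z (\<lambda>ys. sV c (F ys)) zs = sV c (der z F zs)"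
  by (induction zs arbitrary: F F') (simp_all add: V_simps algebra_simps)

lemma der_diff: "der z (\<lambda>ys. F ys - F' ys) zs = der z F zs - der z F' zs"
  using der_linear(1)[of z "\<lambda>ys. F ys - F' ys" F' zs] by simp

lemma dbr_linear:
  "dbr (\<lambda>ys. F ys + F' ys) zs = dbr F zs + dbr F' zs"
  "dbr (\<lambda>ys. sV c (F ys)) zs = sV c (dbr F zs)"
  by (induction zs arbitrary: F F') (simp_all add: V_simps der_linear)

lemma dbr_diff: "dbr (\<lambda>ys. F ys - F' ys) zs = dbr F zs - dbr F' zs"
  using dbr_linear(1)[of "\<lambda>ys. F ys - F' ys" F' zs] by simp

lemma ract_linear:
  "ract n q z (\<lambda>ys. F ys + F' ys) zs = ract n q z F zs + ract n q z F' zs"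
  "ract n q z (\<lambda>ys. F ys - F' ys) zs = ract n q z F zs - ract n q z F' zs"
  "ract n q z (\<lambda>ys. sV c (F ys)) zs = sV c (ract n q z F zs)"
  by (simp_all add: ract_def V_simps act_simps algebra_simps)

lemma dact_linear:
  "dact n q (\<lambda>ys. F ys + F' ys) zs = dact n q F zs + dact n q F' zs"
  "dact n q (\<lambda>ys. sV c (F ys)) zs = sV c (dact n q F zs)"
  by (induction zs arbitrary: F F') (simp_all add: V_simps ract_linear)

lemma dact_diff: "dact n q (\<lambda>ys. F ys - F' ys) zs = dact n q F zs - dact n q F' zs"
  using dact_linear(1)[of n q "\<lambda>ys. F ys - F' ys" F' zs] by simp

text \<open>All summands of \<open>der z\<close> evaluate at lists of the same total parity
  \<open>fst z + par zs\<close>, so sign and action can be pulled out together. In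
  \<open>dbr_act\<close> the total parity does not change, as the arguments are only bracketed with
  each other.\<close>

lemma der_act:
  "der z (\<lambda>ys. sV (par_sign (p * (q + par ys))) (act x (F ys))) zs
    = sV (par_sign (p * (q + fst z + par zs))) (act x (der z F zs))"
proof (induction zs arbitrary: F q)
  case Nil then show ?case by (simp add: act_simps)
next
  case (Cons w zs)
  show ?case using Cons.IH[of "q + fst w" "\<lambda>ys. F (tw w # ys)"]
    by (simp add: V_simps act_simps bk_def ac_simps)
qed

lemma dbr_act:
  "dbr (\<lambda>ys. sV (par_sign (p * (q + par ys))) (act x (F ys))) zs
    = sV (par_sign (p * (q + par zs))) (act x (dbr F zs))"
proof (induction zs arbitrary: F q)
  case Nil then show ?case by (simp add: act_simps)
next
  case (Cons w zs)
  show ?case using Cons.IH[of "q + fst w" "\<lambda>ys. F (tw w # ys)"]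
    by (simp add: V_simps act_simps der_act ac_simps)
qed

section \<open>Twisting, commutation relations, and the square of the coboundary\<close>

lemma der_map_tw: "der (tw z) F (map tw zs) = der z (\<lambda>ys. F (map tw ys)) zs"
  by (induction zs arbitrary: F) (simp_all add: tw_bk)

lemma dbr_map_tw: "dbr F (map tw zs) = dbr (\<lambda>ys. F (map tw ys)) zs"
  by (induction zs arbitrary: F) (simp_all add: der_map_tw)

text \<open>The acting element is twisted too, whence the exponent \<open>Suc n\<close>.\<close>

lemma dact_map_tw: "dact n q F (map tw zs) = dact (Suc n) q (\<lambda>ys. F (map tw ys)) zs"
  by (induction zs arbitrary: F) (simp_all add: ract_def funpow_swap1)

text \<open>This is the twisted representation property of \<open>R\<close>. Terms in which
  \<open>z\<close> and \<open>w\<close> hit different arguments occur on both sides and cancel;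
  terms in which both hit the same argument are related by \<open>jacobi_right\<close>.\<close>

lemma der_der:
  assumes "mlin F" "homog z" "homog w" "\<forall>y\<in>set ys. homog y"
  shows "der w (der (tw z) F) ys
    = der (bk w z) F (map tw ys) + sV (sg z w) (der z (der (tw w) F) ys)"
  using assms
proof (induction ys arbitrary: F)
  case Nil then show ?case by simp
next
  case (Cons y ys)
  have "br (br (snd y) (snd w)) (\<alpha> (snd z)) = br (\<alpha> (snd y)) (br (snd w) (snd z))
      + sG (sg w z) (br (br (snd y) (snd z)) (\<alpha> (snd w)))"
    using Cons.prems jacobi_right[of "snd y" "fst y" "snd w" "fst w" "snd z" "fst z"]
    by (simp add: sg_def)
  \<comment> \<open>Both elements hit the last argument \<open>y\<close>.\<close>
  then have jac: "F (bk (bk y w) (tw z) # us) = F (bk (tw y) (bk w z) # us)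
      + sV (sg z w) (F (bk (bk y z) (tw w) # us))" for us
    using mlin_head[OF Cons.prems(1)] by (simp add: bk_def ac_simps sg_commute)
  have IH: "der w (der (tw z) (\<lambda>us. F (tw (tw y) # us))) ys
    = der (bk w z) (\<lambda>us. F (tw (tw y) # us)) (map tw ys) + sV (sg z w) (der z (der (tw w) (\<lambda>us. F (tw (tw y) # us))) ys)"
    using Cons.IH[OF mlin_Cons[OF Cons.prems(1)]] Cons.prems by simp
  show ?case
    by (simp add: der_linear der_diff der_map_tw IH jac tw_bk V_simps sg_bk algebra_simps sg_commute)
qed

text \<open>Splitting off the last argument \<open>w\<close>, the term where \<open>z\<close> hits
  \<open>w\<close> produces the derivation of \<open>bk w z\<close>. By \<open>der_der\<close> this
  is the super commutator of the derivations of \<open>w\<close> and \<open>z\<close>, whose two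
  halves complete the other terms.\<close>

lemma der_dbr:
  assumes "mlin F" "homog z" "\<forall>y\<in>set zs. homog y"
  shows "der z (dbr F) zs = dbr (der (tw z) F) zs"
  using assms
proof (induction zs arbitrary: F)
  case Nil then show ?case by simp
next
  case (Cons w zs)
  have IH: "der z (dbr (\<lambda>us. F (tw (tw w) # us))) zs = dbr (der (tw z) (\<lambda>us. F (tw (tw w) # us))) zs"
    using Cons.IH[OF mlin_Cons[OF Cons.prems(1)]] Cons.prems by simp
  show ?case using der_der[of F z w zs] Cons.prems
    by (simp add: der_linear der_diff dbr_linear dbr_diff dbr_map_tw IH tw_bk V_simps algebra_simps)
qed

text \<open>Removing the last argument from both operators leaves the difference of the two sides of
  \<open>der_dbr\<close> and an instance of the claim with one argument fewer.\<close>

lemma dbr_dbr: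
  assumes "mlin F" "\<forall>y\<in>set zs. homog y"
  shows "dbr (dbr F) zs = 0"
  using assms
proof (induction zs arbitrary: F)
  case (Cons z zs)
  have "dbr (dbr (\<lambda>us. F (tw (tw z) # us))) zs = 0"
    using Cons.IH[OF mlin_Cons[OF Cons.prems(1)]] Cons.prems by simp
  then show ?case using der_dbr[of F z zs] Cons.prems by (simp add: dbr_linear dbr_diff)
qed simp

text \<open>
  In the induction \<open>F\<close> and \<open>H\<close> are \<open>f\<close> with last arguments \<open>\<alpha> x\<close> and \<open>x\<close> fixed, respectively: neither is
  equivariant, only the relation \<open>F \<circ> \<alpha> = \<beta> \<circ> H\<close> survives.
\<close>

lemma ract_dact:
  assumes "\<And>ys. F (map tw ys) = \<beta> (H ys)" "homog z" "\<forall>y\<in>set zs. homog y"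
  shows "ract (Suc n) q z (dact n q H) zs + der z (dact n q F) zs
    = dact (Suc n) q (ract n q z H) zs + dact (Suc n) q (der z F) zs"
  using assms
proof (induction zs arbitrary: F H)
  case Nil then show ?case by (simp add: ract_def act_simps)
next
  case (Cons w zs)
  have IH: "der z (dact n q (\<lambda>us. F (tw w # us))) zs
    = dact (Suc n) q (ract n q z (\<lambda>us. H (w # us))) zs
      + dact (Suc n) q (der z (\<lambda>us. F (tw w # us))) zs - ract (Suc n) q z (dact n q (\<lambda>us. H (w # us))) zs"
    using Cons.IH[of "\<lambda>us. F (tw w # us)" "\<lambda>us. H (w # us)"] Cons.prems(1)[of "w # _"] Cons.prems
    by (simp add: algebra_simps)
  \<comment> \<open>The argument \<open>w\<close> joins those that \<open>z\<close> has to
    pass.\<close>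
  have rC: "ract n q z F (w # ys) = sV (sg z w) (ract n q z (\<lambda>us. F (w # us)) ys)" for F n ys
    by (simp add: ract_def sg_def V_simps par_sign_add distrib_left ac_simps)
  have 2: "der z (ract n q (tw w) F) zs = sV (sg z w) (ract (Suc n) q w (der z F) zs)"
    unfolding ract_def der_act
    by (simp add: sg_def V_simps par_sign_add distrib_left ac_simps funpow_swap1)
  have h: "(\<alpha> ^^ n) (snd w) \<in> G (fst w)" "(\<alpha> ^^ n) (snd z) \<in> G (fst z)"
    using Cons.prems by (simp_all add: funpow_alpha_even)
  \<comment> \<open>The relation between \<open>F\<close> and \<open>H\<close> turns the value of
    \<open>F\<close> at twisted arguments into \<open>\<beta> (H zs)\<close>, the form in which the
    module axiom resolves the action of a bracket.\<close>
  have 3: "ract n q (bk w z) F (map tw zs)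
    = ract (Suc n) q w (ract n q z H) zs - sV (sg z w) (ract (Suc n) q z (ract n q w H) zs)"
    using act_br'[OF h, of "H zs"]
    by (simp add: ract_def bk_def Cons.prems(1) sg_def V_simps par_sign_add distrib_left distrib_right
        ac_simps act_simps funpow_alpha_br)
  show ?case
    by (simp add: rC der_linear der_diff dact_linear dact_diff ract_linear dact_map_tw IH 2 3 V_simps)
qed

text \<open>The mixed terms of the squared coboundary; \<open>dop_dop\<close> takes \<open>F\<close>
  and \<open>H\<close> equal. The terms in which exactly one operator moves the last argument cancel
  by \<open>ract_dact\<close> and step \<open>1\<close>, the others by induction.\<close>

lemma dact_dbr:
  assumes "\<And>ys. F (map tw ys) = \<beta> (H ys)" "\<forall>y\<in>set zs. homog y"
  shows "dact (Suc n) q (dact n q H) zs + dact (Suc n) q (dbr F) zs + dbr (dact n q F) zs = 0"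
  using assms
proof (induction zs arbitrary: F H)
  case Nil then show ?case by simp
next
  case (Cons z zs)
  have IH: "dbr (dact n q (\<lambda>us. F (tw z # us))) zs =
      - dact (Suc n) q (dact n q (\<lambda>us. H (z # us))) zs - dact (Suc n) q (dbr (\<lambda>us. F (tw z # us))) zs"
    using Cons.IH[of "\<lambda>us. F (tw z # us)" "\<lambda>us. H (z # us)"] Cons.prems(1)[of "z # _"] Cons.prems
    by (simp add: algebra_simps eq_neg_iff_add_eq_0)
  have 1: "dbr (ract n q (tw z) F) zs = ract (Suc n) q z (dbr F) zs"
    unfolding ract_def dbr_act by (simp add: funpow_swap1)
  show ?case using ract_dact[of F H z zs n q] Cons.prems
    by (simp add: dact_linear dact_diff ract_linear dbr_linear dbr_diff IH 1 algebra_simps)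
qed

text \<open>The coboundary of a \<open>k\<close>-cochain of parity \<open>q\<close> without its
  global sign \<open>(-1) ^ k\<close>, for \<open>n = k + r - 1\<close>.\<close>

definition dop :: "nat \<Rightarrow> bit \<Rightarrow> ((bit \<times> 'g) list \<Rightarrow> 'v) \<Rightarrow> (bit \<times> 'g) list \<Rightarrow> 'v" where
  "dop n q F = (\<lambda>zs. dbr F zs + dact n q F zs)"

lemma dop_dop:
  assumes "mlin F" "\<And>ys. F (map tw ys) = \<beta> (F ys)" "\<forall>y\<in>set zs. homog y"
  shows "dop (Suc n) q (dop n q F) zs = 0"
  using dbr_dbr[OF assms(1,3)] dact_dbr[of F F zs n q] assms(2,3)
  by (simp add: dop_def dbr_linear dact_linear algebra_simps)

lemma dop_scale: "dop n q (\<lambda>ys. sV c (F ys)) zs = sV c (dop n q F zs)"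
  by (simp add: dop_def dbr_linear dact_linear V_simps)

lemma dop_add: "dop n q (\<lambda>ys. F ys + F' ys) zs = dop n q F zs + dop n q F' zs"
  by (simp add: dop_def dbr_linear dact_linear)

section \<open>Restriction to homogeneous arguments\<close>

lemma der_cong:
  assumes "\<And>ys. length ys = length zs \<Longrightarrow> \<forall>y\<in>set ys. homog y \<Longrightarrow> F ys = F' ys"
    "homog z" "\<forall>y\<in>set zs. homog y"
  shows "der z F zs = der z F' zs"
  using assms
proof (induction zs arbitrary: F F')
  case (Cons w zs)
  have "der z (\<lambda>ys. F (tw w # ys)) zs = der z (\<lambda>ys. F' (tw w # ys)) zs"
    using Cons.prems by (intro Cons.IH) (auto simp: alpha_even)
  moreover have "F (bk w z # map tw zs) = F' (bk w z # map tw zs)"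
    using Cons.prems by (intro Cons.prems(1)) (auto simp: alpha_even homog_bk)
  ultimately show ?case by simp
qed simp

lemma dbr_cong:
  assumes "\<And>ys. Suc (length ys) = length zs \<Longrightarrow> \<forall>y\<in>set ys. homog y \<Longrightarrow> F ys = F' ys"
    "\<forall>y\<in>set zs. homog y"
  shows "dbr F zs = dbr F' zs"
  using assms
proof (induction zs arbitrary: F F')
  case (Cons z zs)
  have "dbr (\<lambda>ys. F (tw z # ys)) zs = dbr (\<lambda>ys. F' (tw z # ys)) zs"
    using Cons.prems by (intro Cons.IH) (auto simp: alpha_even)
  moreover have "der z F zs = der z F' zs"
    using Cons.prems by (intro der_cong) auto
  ultimately show ?case by simp
qed simp

lemma dact_cong:
  assumes "\<And>ys. Suc (length ys) = length zs \<Longrightarrow> \<forall>y\<in>set ys. homog y \<Longrightarrow> F ys = F' ys"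
    "\<forall>y\<in>set zs. homog y"
  shows "dact n q F zs = dact n q F' zs"
  using assms
proof (induction zs arbitrary: F F')
  case (Cons z zs)
  have "dact n q (\<lambda>ys. F (z # ys)) zs = dact n q (\<lambda>ys. F' (z # ys)) zs"
    using Cons.prems by (intro Cons.IH) auto
  then show ?case using Cons.prems by (simp add: ract_def)
qed simp

text \<open>Needed to iterate: the description of a coboundary by \<open>dop\<close> holds at
  homogeneous arguments only.\<close>

lemma dop_cong:
  assumes "\<And>ys. Suc (length ys) = length zs \<Longrightarrow> \<forall>y\<in>set ys. homog y \<Longrightarrow> F ys = F' ys"
    "\<forall>y\<in>set zs. homog y"
  shows "dop n q F zs = dop n q F' zs"
  using dbr_cong[OF assms] dact_cong[OF assms] by (simp add: dop_def)

section \<open>Multilinearity of the coboundary\<close>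

lemma mlinD:
  assumes "mlin F"
  shows "F (ys @ (p, x + y) # zs) = F (ys @ (p, x) # zs) + F (ys @ (p, y) # zs)"
    "F (ys @ (p, sG c x) # zs) = sV c (F (ys @ (p, x) # zs))"
  using assms unfolding mlin_def by blast+

lemma mlin_der:
  assumes "mlin F" shows "mlin (der z F)"
proof -
  have "der z F (ys @ (p, x + y) # zs) = der z F (ys @ (p, x) # zs) + der z F (ys @ (p, y) # zs)
      \<and> der z F (ys @ (p, sG c x) # zs) = sV c (der z F (ys @ (p, x) # zs))" for ys p x y zs c
    using assms
  proof (induction ys arbitrary: F)
    case Nil
    then show ?case
      by (simp add: bk_def tw_def sg_def br_simps alpha_simps mlin_head der_linear V_simps ac_simps)
  next
    case (Cons w ys)
    note IH = Cons.IH[OF mlin_Cons[OF Cons.prems, of "tw w"]]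
    show ?case using IH mlinD[OF Cons.prems, of "bk w z # map tw ys"]
      by (simp add: tw_def[of "(_, _)"] alpha_simps V_simps ac_simps)
  qed
  then show ?thesis unfolding mlin_def by blast
qed

text \<open>The last argument of \<open>dbr F\<close> enters as the derivation index, so
  multilinearity of \<open>dbr F\<close> needs linearity there.\<close>

lemma der_linear_left:
  assumes "mlin F"
  shows "der (p, x + y) F zs = der (p, x) F zs + der (p, y) F zs"
    and "der (p, sG c x) F zs = sV c (der (p, x) F zs)"
proof -
  have "der (p, x + y) F zs = der (p, x) F zs + der (p, y) F zs
      \<and> der (p, sG c x) F zs = sV c (der (p, x) F zs)"
    using assms
  proof (induction zs arbitrary: F)
    case (Cons w zs)
    then show ?case using Cons.IH[OF mlin_Cons[OF Cons.prems, of "tw w"]]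
      by (simp add: bk_def sg_def br_simps mlin_head[OF Cons.prems] V_simps ac_simps)
  qed simp
  then show "der (p, x + y) F zs = der (p, x) F zs + der (p, y) F zs"
    "der (p, sG c x) F zs = sV c (der (p, x) F zs)" by blast+
qed

lemma mlin_dbr:
  assumes "mlin F" shows "mlin (dbr F)"
proof -
  have "dbr F (ys @ (p, x + y) # zs) = dbr F (ys @ (p, x) # zs) + dbr F (ys @ (p, y) # zs)
      \<and> dbr F (ys @ (p, sG c x) # zs) = sV c (dbr F (ys @ (p, x) # zs))" for ys p x y zs c
    using assms
  proof (induction ys arbitrary: F)
    case Nil
    then show ?case
      by (simp add: tw_def alpha_simps mlin_head dbr_linear der_linear_left V_simps ac_simps)
  next
    case (Cons w ys)
    note IH = Cons.IH[OF mlin_Cons[OF Cons.prems, of "tw w"]]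
    show ?case using IH mlinD[OF mlin_der[OF Cons.prems], of w ys]
      by (simp add: V_simps)
  qed
  then show ?thesis unfolding mlin_def by blast
qed

lemma mlin_ract:
  assumes "mlin F" shows "mlin (ract n q z F)"
  unfolding mlin_def ract_def by (simp add: mlinD[OF assms] act_simps V_simps ac_simps)

lemma mlin_dact:
  assumes "mlin F" shows "mlin (dact n q F)"
proof -
  have "dact n q F (ys @ (p, x + y) # zs) = dact n q F (ys @ (p, x) # zs) + dact n q F (ys @ (p, y) # zs)
      \<and> dact n q F (ys @ (p, sG c x) # zs) = sV c (dact n q F (ys @ (p, x) # zs))" for ys p x y zs c
    using assms
  proof (induction ys arbitrary: F)
    case Nil
    have "ract n q (p, x + y) F zs = ract n q (p, x) F zs + ract n q (p, y) F zs"
      "ract n q (p, sG c x) F zs = sV c (ract n q (p, x) F zs)"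
      by (simp_all add: ract_def funpow_alpha_simps act_simps V_simps ac_simps)
    with Nil show ?case
      by (simp add: mlin_head dact_linear V_simps)
  next
    case (Cons w ys)
    note IH = Cons.IH[OF mlin_Cons[OF Cons.prems, of w]]
    show ?case using IH mlinD[OF mlin_ract[OF Cons.prems], of n q w ys]
      by (simp add: V_simps)
  qed
  then show ?thesis unfolding mlin_def by blast
qed

lemma mlin_dop: "mlin F \<Longrightarrow> mlin (dop n q F)"
  using mlin_dbr[of F] mlin_dact[of F n q] unfolding mlin_def dop_def
  by (simp add: V_simps)

section \<open>Symmetry, parity and equivariance of the coboundary\<close>

definition skew :: "((bit \<times> 'g) list \<Rightarrow> 'v) \<Rightarrow> bool" where
  "skew F \<longleftrightarrow> (\<forall>ys a b zs. (\<forall>y\<in>set (ys @ a # b # zs). homog y) \<longrightarrow>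
     F (ys @ a # b # zs) = - sV (sg a b) (F (ys @ b # a # zs)))"

lemma skewD:
  "skew F \<Longrightarrow> \<forall>y\<in>set (ys @ a # b # zs). homog y \<Longrightarrow>
    F (ys @ a # b # zs) = - sV (sg a b) (F (ys @ b # a # zs))"
  unfolding skew_def by blast

lemma skewI:
  "(\<And>ys a b zs. \<forall>y\<in>set (ys @ a # b # zs). homog y \<Longrightarrow>
    F (ys @ a # b # zs) = - sV (sg a b) (F (ys @ b # a # zs))) \<Longrightarrow> skew F"
  unfolding skew_def by blast

lemma skew_Cons:
  assumes "skew F" "homog z" shows "skew (\<lambda>ys. F (z # ys))"
proof (rule skewI)
  fix ys a b zs assume "\<forall>y\<in>set (ys @ a # b # zs). homog y"
  then show "F (z # ys @ a # b # zs) = - sV (sg a b) (F (z # ys @ b # a # zs))"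
    using skewD[OF assms(1), of "z # ys" a b zs] assms(2) by simp
qed

text \<open>The term where \<open>z\<close> hits \<open>a\<close> is exchanged with the one where it
  hits \<open>a\<close> after the swap, and likewise for \<open>b\<close>. The parity that the
  bracket gains from \<open>z\<close> gives the extra sign of \<open>z\<close> passing the
  neighbour.\<close>

lemma der_skew:
  assumes "skew F" "homog z" shows "skew (der z F)"
proof -
  have "der z F (ys @ a # b # zs) = - sV (sg a b) (der z F (ys @ b # a # zs))"
    if "\<forall>y\<in>set (ys @ a # b # zs). homog y" for ys a b zs
    using assms(1) that
  proof (induction ys arbitrary: F)
    case Nil
    \<comment> \<open>The minus sign is absorbed into the scalar so that linearity in the cochain
      can extract it.\<close>
    have "der z (\<lambda>ys. F (tw a # tw b # ys)) zs = der z (\<lambda>ys. sV (- sg a b) (F (tw b # tw a # ys))) zs"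
      using Nil assms skewD[OF Nil(1), of "[]" "tw a" "tw b"]
      by (intro der_cong) (auto simp: alpha_even V.scale_minus_left)
    also have "\<dots> = - sV (sg a b) (der z (\<lambda>ys. F (tw b # tw a # ys)) zs)"
      unfolding der_linear by simp
    finally have swap: "der z (\<lambda>ys. F (tw a # tw b # ys)) zs = \<dots>" .
    have "F (bk a z # tw b # map tw zs) = - sV (sg a b * sg z b) (F (tw b # bk a z # map tw zs))"
      using Nil assms skewD[OF Nil(1), of "[]" "bk a z" "tw b" "map tw zs"]
      by (auto simp: alpha_even homog_bk sg_bk)
    moreover have "F (tw a # bk b z # map tw zs) = - sV (sg a b * sg a z) (F (bk b z # tw a # map tw zs))"
      using Nil assms skewD[OF Nil(1), of "[]" "tw a" "bk b z" "map tw zs"]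
      by (auto simp: alpha_even homog_bk sg_bk)
    ultimately show ?case
      by (simp add: swap V_simps ac_simps sg_commute)
  next
    case (Cons w ys)
    have "F (bk w z # map tw ys @ tw a # tw b # map tw zs)
        = - sV (sg a b) (F (bk w z # map tw ys @ tw b # tw a # map tw zs))"
      using Cons.prems assms skewD[OF Cons.prems(1), of "bk w z # map tw ys" "tw a" "tw b" "map tw zs"]
      by (simp add: ball_Un alpha_even homog_bk)
    then show ?case
      using Cons.IH[OF skew_Cons[OF Cons.prems(1), of "tw w"]] Cons.prems
      by (simp add: alpha_even V_simps ac_simps)
  qed
  then show ?thesis by (rule skewI)
qed

lemma mlin_bk_swap:
  assumes "mlin F" "homog a" "homog b"
  shows "F (bk b a # zs) = - sV (sg a b) (F (bk a b # zs))"
proof -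
  have "br (snd b) (snd a) = sG (- sg a b) (br (snd a) (snd b))"
    using super_skew[OF assms(3,2)] by (simp add: sg_def mult.commute)
  then show ?thesis
    by (simp only: bk_def mlin_head(2)[OF assms(1)] add.commute[of "fst b"]) simp
qed

text \<open>For the last two arguments, the term bracketing them with each other changes by skew
  symmetry of the bracket (\<open>mlin_bk_swap\<close>), and the terms moving one of them to earlier
  places are interchanged. A swap further in front is covered by \<open>der_skew\<close> and
  induction.\<close>

lemma dbr_skew:
  assumes "mlin F" "skew F" shows "skew (dbr F)"
proof -
  have "dbr F (ys @ a # b # zs) = - sV (sg a b) (dbr F (ys @ b # a # zs))"
    if "\<forall>y\<in>set (ys @ a # b # zs). homog y" for ys a b zs
    using assms that
  proof (induction ys arbitrary: F)
    case Nil
    have "dbr (\<lambda>ys. F (tw a # tw b # ys)) zs = dbr (\<lambda>ys. sV (- sg a b) (F (tw b # tw a # ys))) zs"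
      using Nil assms skewD[OF Nil(2), of "[]" "tw a" "tw b"]
      by (intro dbr_cong) (auto simp: alpha_even V.scale_minus_left)
    also have "\<dots> = - sV (sg a b) (dbr (\<lambda>ys. F (tw b # tw a # ys)) zs)"
      unfolding dbr_linear by simp
    finally have swap: "dbr (\<lambda>ys. F (tw a # tw b # ys)) zs = \<dots>" .
    with Nil mlin_bk_swap[OF Nil(1), of a b] show ?case
      by (simp add: swap V_simps sg_commute[of b a] algebra_simps)
  next
    case (Cons w ys)
    show ?case
      using Cons.IH[OF mlin_Cons[OF Cons.prems(1)] skew_Cons[OF Cons.prems(2), of "tw w"]]
        skewD[OF der_skew[OF Cons.prems(2), of w], of ys a b zs] Cons.prems
      by (simp add: alpha_even V_simps)
  qed
  then show ?thesis by (rule skewI)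
qed

lemma dact_skew:
  assumes "skew F" shows "skew (dact n q F)"
proof -
  have "dact n q F (ys @ a # b # zs) = - sV (sg a b) (dact n q F (ys @ b # a # zs))"
    if "\<forall>y\<in>set (ys @ a # b # zs). homog y" for ys a b zs
    using assms that
  proof (induction ys arbitrary: F)
    case Nil
    have "dact n q (\<lambda>ys. F (a # b # ys)) zs = dact n q (\<lambda>ys. sV (- sg a b) (F (b # a # ys))) zs"
      using Nil assms skewD[OF Nil(1), of "[]" "a" "b"]
      by (intro dact_cong) (auto simp: V.scale_minus_left)
    also have "\<dots> = - sV (sg a b) (dact n q (\<lambda>ys. F (b # a # ys)) zs)"
      unfolding dact_linear by simp
    finally have swap: "dact n q (\<lambda>ys. F (a # b # ys)) zs = \<dots>" .
    have "ract n q z F (w # ys) = sV (sg z w) (ract n q z (\<lambda>us. F (w # us)) ys)" for z w F ys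
      by (simp add: ract_def sg_def V_simps par_sign_add distrib_left ac_simps)
    then show ?case
      by (simp add: swap V_simps sg_commute[of b a])
  next
    case (Cons w ys)
    have "ract n q w F (ys @ a # b # zs) = - sV (sg a b) (ract n q w F (ys @ b # a # zs))"
      using Cons.prems skewD[OF Cons.prems(1), of ys a b zs]
      by (simp add: ract_def act_simps V_simps ac_simps)
    then show ?case
      using Cons.IH[OF skew_Cons[OF Cons.prems(1), of w]] Cons.prems
      by (simp add: V_simps)
  qed
  then show ?thesis by (rule skewI)
qed

lemma dop_skew:
  assumes "mlin F" "skew F" shows "skew (dop n q F)"
proof (rule skewI)
  fix ys a b zs assume "\<forall>y\<in>set (ys @ a # b # zs). homog y"
  then show "dop n q F (ys @ a # b # zs) = - sV (sg a b) (dop n q F (ys @ b # a # zs))"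
    using skewD[OF dbr_skew[OF assms], of ys a b zs] skewD[OF dact_skew[OF assms(2)], of ys a b zs n q]
    unfolding dop_def by (simp only: V.scale_right_distrib minus_add_distrib)
qed

section \<open>Parity of the coboundary\<close>

lemma der_parity:
  assumes "\<And>ys. \<forall>y\<in>set ys. homog y \<Longrightarrow> F ys \<in> V (q + par ys)" "homog z" "\<forall>y\<in>set zs. homog y"
  shows "der z F zs \<in> V (q + fst z + par zs)"
  using assms
proof (induction zs arbitrary: F q)
  case Nil then show ?case by (simp add: V.zero_part)
next
  case (Cons w zs)
  have "der z (\<lambda>ys. F (tw w # ys)) zs \<in> V (q + fst w + fst z + par zs)"
    using Cons.prems(1)[of "tw w # _"] Cons.prems by (intro Cons.IH) (simp_all add: alpha_even ac_simps)
  moreover have "F (bk w z # map tw zs) \<in> V (q + fst w + fst z + par zs)"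
    using Cons.prems(1)[of "bk w z # map tw zs"] Cons.prems homog_bk[of w z]
    by (simp add: alpha_even bk_def ac_simps)
  ultimately show ?case
    using V.subspace_part by (simp add: V.subspace_add V.subspace_scale ac_simps)
qed

lemma dbr_parity:
  assumes "\<And>ys. \<forall>y\<in>set ys. homog y \<Longrightarrow> F ys \<in> V (q + par ys)" "\<forall>y\<in>set zs. homog y"
  shows "dbr F zs \<in> V (q + par zs)"
  using assms
proof (induction zs arbitrary: F q)
  case Nil then show ?case by (simp add: V.zero_part)
next
  case (Cons z zs)
  have "dbr (\<lambda>ys. F (tw z # ys)) zs \<in> V (q + fst z + par zs)"
    using Cons.prems(1)[of "tw z # _"] Cons.prems by (intro Cons.IH) (simp_all add: alpha_even ac_simps)
  moreover have "der z F zs \<in> V (q + fst z + par zs)"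
    using Cons.prems by (intro der_parity) auto
  ultimately show ?case
    using V.subspace_part by (simp add: V.subspace_diff ac_simps)
qed

text \<open>The parameter \<open>q'\<close> only affects signs, which do not leave a homogeneous
  component; hence it is independent of \<open>q\<close>.\<close>

lemma dact_parity:
  assumes "\<And>ys. \<forall>y\<in>set ys. homog y \<Longrightarrow> F ys \<in> V (q + par ys)" "\<forall>y\<in>set zs. homog y"
  shows "dact n q' F zs \<in> V (q + par zs)"
  using assms
proof (induction zs arbitrary: F q)
  case Nil then show ?case by (simp add: V.zero_part)
next
  case (Cons z zs)
  have "dact n q' (\<lambda>ys. F (z # ys)) zs \<in> V (q + fst z + par zs)"
    using Cons.prems(1)[of "z # _"] Cons.prems by (intro Cons.IH) (simp_all add: ac_simps)
  moreover have "act ((\<alpha> ^^ n) (snd z)) (F zs) \<in> V (fst z + (q + par zs))"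
    using Cons.prems by (intro act_even funpow_alpha_even) auto
  then have "ract n q' z F zs \<in> V (q + fst z + par zs)"
    using V.subspace_part by (simp add: ract_def V.subspace_scale ac_simps)
  ultimately show ?case
    using V.subspace_part by (simp add: V.subspace_diff ac_simps)
qed

lemma dop_parity:
  assumes "\<And>ys. \<forall>y\<in>set ys. homog y \<Longrightarrow> F ys \<in> V (q + par ys)" "\<forall>y\<in>set zs. homog y"
  shows "dop n q' F zs \<in> V (q + par zs)"
  using dbr_parity[OF assms] dact_parity[OF assms] V.subspace_part
  by (simp add: dop_def V.subspace_add)

section \<open>Equivariance of the coboundary\<close>

lemma der_beta: "der z (\<lambda>ys. \<beta> (F ys)) zs = \<beta> (der z F zs)"
  by (induction zs arbitrary: F) (simp_all add: beta_simps)

lemma dbr_beta: "dbr (\<lambda>ys. \<beta> (F ys)) zs = \<beta> (dbr F zs)"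
  by (induction zs arbitrary: F) (simp_all add: beta_simps der_beta)

text \<open>Pulling \<open>\<beta>\<close> out of the action removes one \<open>\<alpha>\<close>
  from the acting element. In \<open>dop_map_tw\<close> this offsets the rise of the exponent in
  \<open>dact_map_tw\<close>.\<close>

lemma dact_beta:
  assumes "\<forall>y\<in>set zs. homog y"
  shows "dact (Suc n) q (\<lambda>ys. \<beta> (F ys)) zs = \<beta> (dact n q F zs)"
  using assms
proof (induction zs arbitrary: F)
  case Nil then show ?case by (simp add: beta_simps)
next
  case (Cons z zs)
  have "act (\<alpha> ((\<alpha> ^^ n) (snd z))) (\<beta> v) = \<beta> (act ((\<alpha> ^^ n) (snd z)) v)" for v
    using Cons.prems by (intro act_alpha_beta'[of _ "fst z"] funpow_alpha_even) simp
  then show ?case using Cons by (simp add: beta_simps ract_def)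
qed

lemma dop_map_tw:
  assumes "\<And>ys. F (map tw ys) = \<beta> (F ys)" "\<forall>y\<in>set zs. homog y"
  shows "dop n q F (map tw zs) = \<beta> (dop n q F zs)"
  by (simp add: dop_def dbr_map_tw dact_map_tw assms(1) dbr_beta dact_beta[OF assms(2)] beta_simps)

section \<open>Comparison with the explicit formula\<close>

text \<open>The bridge from cochains on vectors to labelled, reversed lists; the labels influence
  only signs.\<close>

definition lab :: "('g list \<Rightarrow> 'v) \<Rightarrow> (bit \<times> 'g) list \<Rightarrow> 'v" where
  "lab f zs = f (rev (map snd zs))"

lemma lab_Cons: "(\<lambda>ys. lab f (z # ys)) = lab (\<lambda>xs. f (xs @ [snd z]))"
  by (simp add: lab_def fun_eq_iff)

lemma der_lab:
  "der z (lab f) (rev us) = (\<Sum>s<length us. sV (par_sign (fst z * (\<Sum>i\<in>{s<..<length us}. map fst us ! i)))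
     (f ((map \<alpha> (map snd us))[s := br (map snd us ! s) (snd z)])))"
proof (induction us arbitrary: f rule: rev_induct)
  case Nil then show ?case by simp
next
  case (snoc w us)
  \<comment> \<open>To reach a position before \<open>w\<close>, the element \<open>z\<close> also
    passes \<open>w\<close>; at the position of \<open>w\<close> itself the interval is
    empty.\<close>
  have "(\<Sum>i\<in>{s<..<Suc (length us)}. map fst (us @ [w]) ! i)
      = fst w + (\<Sum>i\<in>{s<..<length us}. map fst us ! i)" if "s < length us" for s
  proof -
    have "{s<..<Suc (length us)} = insert (length us) {s<..<length us}" using that by auto
    then show ?thesis by (simp add: nth_append)
  qed
  then have "(\<Sum>s<length us. sV (par_sign (fst z * (\<Sum>i\<in>{s<..<length (us @ [w])}. map fst (us @ [w]) ! i)))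
     (f ((map \<alpha> (map snd (us @ [w])))[s := br (map snd (us @ [w]) ! s) (snd z)])))
    = sV (sg z w) (der z (lab (\<lambda>xs. f (xs @ [\<alpha> (snd w)]))) (rev us))"
    unfolding snoc.IH V.scale_sum_right
    by (intro sum.cong refl)
      (simp add: nth_append list_update_append par_sign_add distrib_left sg_def)
  moreover have "{length us<..<Suc (length us)} = {}" by auto
  ultimately show ?case
    by (simp add: lab_Cons list_update_append nth_append bk_def)
      (simp add: lab_def rev_map o_def)
qed

lemma omit_append: "t < length xs \<Longrightarrow> omit t (xs @ ys) = omit t xs @ ys"
  by (simp add: omit_def)

lemma omit_last: "omit (length xs) (xs @ [y]) = xs"
  by (simp add: omit_def)

text \<open>The formula alternates from the first argument on, the recursion from the last one,
  which accounts for the global sign. The summand for the last \<open>t\<close> is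
  \<open>der\<close>, the others follow by induction; \<open>dact_lab\<close> has the same
  structure.\<close>

lemma dbr_lab:
  "(\<Sum>t<length us. \<Sum>s<t. sV ((-1) ^ t * par_sign (map fst us ! t * (\<Sum>i\<in>{s<..<t}. map fst us ! i)))
       (f (omit t ((map \<alpha> (map snd us))[s := br (map snd us ! s) (map snd us ! t)]))))
    = sV ((-1) ^ Suc (length us)) (dbr (lab f) (rev us))"
proof (induction us arbitrary: f rule: rev_induct)
  case Nil then show ?case by simp
next
  case (snoc w us)
  have "(\<Sum>t<length us. \<Sum>s<t. sV ((-1) ^ t * par_sign (map fst (us @ [w]) ! t * (\<Sum>i\<in>{s<..<t}. map fst (us @ [w]) ! i)))
       (f (omit t ((map \<alpha> (map snd (us @ [w])))[s := br (map snd (us @ [w]) ! s) (map snd (us @ [w]) ! t)]))))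
     = sV ((-1) ^ Suc (length us)) (dbr (lab (\<lambda>xs. f (xs @ [\<alpha> (snd w)]))) (rev us))"
    unfolding snoc.IH[symmetric]
    by (intro sum.cong refl arg_cong2[of _ _ _ _ sV] arg_cong2[of _ _ _ _ "(*)"] arg_cong[of _ _ par_sign] arg_cong[of _ _ f])
      (auto simp: nth_append list_update_append omit_append)
  moreover have "(\<Sum>s<length us. sV ((-1) ^ length us * par_sign (map fst (us @ [w]) ! length us * (\<Sum>i\<in>{s<..<length us}. map fst (us @ [w]) ! i)))
       (f (omit (length us) ((map \<alpha> (map snd (us @ [w])))[s := br (map snd (us @ [w]) ! s) (map snd (us @ [w]) ! length us)]))))
     = sV ((-1) ^ length us) (der w (lab f) (rev us))"
    unfolding der_lab V.scale_sum_right
    using omit_last[of "(map \<alpha> (map snd us))[_ := _]"]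
    by (intro sum.cong refl) (simp add: nth_append list_update_append V_simps)
  ultimately show ?case
    by (simp add: lab_Cons V_simps)
qed

lemma dact_lab:
  "(\<Sum>s<length us. sV ((-1) ^ s * par_sign (map fst us ! s * (q + (\<Sum>i<s. map fst us ! i))))
       (act ((\<alpha> ^^ n) (map snd us ! s)) (f (omit s (map snd us)))))
    = sV ((-1) ^ Suc (length us)) (dact n q (lab f) (rev us))"
proof (induction us arbitrary: f rule: rev_induct)
  case Nil then show ?case by simp
next
  case (snoc w us)
  have "(\<Sum>s<length us. sV ((-1) ^ s * par_sign (map fst (us @ [w]) ! s * (q + (\<Sum>i<s. map fst (us @ [w]) ! i))))
       (act ((\<alpha> ^^ n) (map snd (us @ [w]) ! s)) (f (omit s (map snd (us @ [w]))))))
     = sV ((-1) ^ Suc (length us)) (dact n q (lab (\<lambda>xs. f (xs @ [snd w]))) (rev us))"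
    unfolding snoc.IH[symmetric]
    by (intro sum.cong refl arg_cong2[of _ _ _ _ sV] arg_cong2[of _ _ _ _ "(*)"] arg_cong[of _ _ par_sign]
        arg_cong2[of _ _ _ _ act] arg_cong2[of _ _ _ _ "(+)"] arg_cong[of _ _ f])
      (auto simp: nth_append omit_append)
  moreover have "(\<Sum>i<length us. map fst (us @ [w]) ! i) = par (rev us)"
  proof -
    have "(\<Sum>i<length us. map fst (us @ [w]) ! i) = par us"
      by (simp add: sum_list_sum_nth lessThan_atLeast0 nth_append)
    then show ?thesis by (simp add: rev_map[symmetric])
  qed
  then have "sV ((-1) ^ length us * par_sign (map fst (us @ [w]) ! length us * (q + (\<Sum>i<length us. map fst (us @ [w]) ! i))))
       (act ((\<alpha> ^^ n) (map snd (us @ [w]) ! length us)) (f (omit (length us) (map snd (us @ [w])))))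
     = sV ((-1) ^ length us) (ract n q w (lab f) (rev us))"
    using omit_last[of "map snd us"] by (simp add: nth_append V_simps ract_def lab_def rev_map)
  ultimately show ?case
    by (simp add: lab_Cons V_simps)
qed

lemma delta_homogeneous_lab:
  assumes "length xs = Suc k" "length ps = Suc k"
  shows "delta_homogeneous sV br \<alpha> act r k q f ps xs
    = sV ((-1) ^ k) (dop (k + r - 1) q (lab f) (rev (zip ps xs)))"
  using dbr_lab[of "zip ps xs" f] dact_lab[of "zip ps xs" q "k + r - 1" f] assms
  by (simp add: delta_homogeneous_def dop_def lessThan_Suc_atMost V_simps del: map_map)

section \<open>Cochains\<close>

abbreviation homs :: "'g list \<Rightarrow> bit list \<Rightarrow> bool" where
  "homs xs ps \<equiv> list_all2 (\<lambda>x p. x \<in> G p) xs ps"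

section \<open>Multilinear maps and cochains in list form\<close>

lemma multilin_iff:
  "multilin sG sV k f \<longleftrightarrow> (\<forall>xs i x y c. length xs = k \<longrightarrow> i < k \<longrightarrow>
    f (xs[i := x + y]) = f (xs[i := x]) + f (xs[i := y]) \<and> f (xs[i := sG c x]) = sV c (f (xs[i := x])))"
  unfolding multilin_def Vector_Spaces.linear_iff
  using vector_space_axioms V.vector_space_axioms by blast

lemma multilinD:
  assumes "multilin sG sV k f" "length xs = k" "i < k"
  shows "f (xs[i := x + y]) = f (xs[i := x]) + f (xs[i := y])"
    "f (xs[i := sG c x]) = sV c (f (xs[i := x]))"
  using assms unfolding multilin_iff by blast+

lemma multilinI:
  assumes "\<And>xs i x y. length xs = k \<Longrightarrow> i < k \<Longrightarrow> f (xs[i := x + y]) = f (xs[i := x]) + f (xs[i := y])"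
    "\<And>xs i c x. length xs = k \<Longrightarrow> i < k \<Longrightarrow> f (xs[i := sG c x]) = sV c (f (xs[i := x]))"
  shows "multilin sG sV k f"
  using assms unfolding multilin_iff by blast

text \<open>Each argument is a sum of an even and an odd one, so homogeneous arguments determine a
  multilinear map.\<close>

lemma multilin_eqI:
  assumes "multilin sG sV k f" "multilin sG sV k g" "length xs = k"
    "\<And>xs ps. length xs = k \<Longrightarrow> homs xs ps \<Longrightarrow> f xs = g xs"
  shows "f xs = g xs"
proof -
  \<comment> \<open>Induction on \<open>m\<close>, where only the positions below \<open>m\<close>
    may be inhomogeneous.\<close>
  have "f xs = g xs"
    if "m \<le> k" "length xs = k" "\<And>i. m \<le> i \<Longrightarrow> i < k \<Longrightarrow> \<exists>p. xs ! i \<in> G p" for m xs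
    using that
  proof (induction m arbitrary: xs)
    case 0
    then have "homs xs (map (\<lambda>x. SOME p. x \<in> G p) xs)"
      by (auto simp: list_all2_conv_all_nth intro: someI_ex)
    then show ?case using assms(4) 0 by blast
  next
    case (Suc m)
    obtain y z where yz: "y \<in> G 0" "z \<in> G 1" "xs ! m = y + z" using parts_span by blast
    have xs: "xs = xs[m := y + z]" using yz by (metis list_update_id)
    have "f (xs[m := w]) = g (xs[m := w])" if "w \<in> G p" for w p
    proof (rule Suc.IH)
      fix i assume "m \<le> i" "i < k"
      then show "\<exists>p. xs[m := w] ! i \<in> G p"
        using that Suc.prems by (cases "i = m") auto
    qed (use Suc.prems in auto)
    then have "f (xs[m := y + z]) = g (xs[m := y + z])"
      using yz Suc.prems multilinD(1)[OF assms(1), of xs m] multilinD(1)[OF assms(2), of xs m] by auto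
    then show ?case using xs by simp
  qed
  from this[of k xs] show ?thesis using assms(3) by auto
qed

lemma homs_zip: "homs xs ps \<Longrightarrow> \<forall>y\<in>set (zip ps xs). homog y"
  by (auto simp: list_all2_conv_all_nth in_set_zip)

lemma homs_rev_unzip: "\<forall>y\<in>set ys. homog y \<Longrightarrow> homs (rev (map snd ys)) (rev (map fst ys))"
  by (simp add: list_all2_map1 list_all2_map2 list_all2_same)

lemma mlin_lab:
  assumes "multilin sG sV k f" "\<And>xs. length xs \<noteq> k \<Longrightarrow> f xs = 0"
  shows "mlin (lab f)"
proof -
  have "f (l @ (x + y) # u) = f (l @ x # u) + f (l @ y # u) \<and> f (l @ sG c x # u) = sV c (f (l @ x # u))"
    for l u x y c
  proof (cases "length (l @ x # u) = k")
    case True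
    then show ?thesis
      using multilinD[OF assms(1), of "l @ x # u" "length l"] by (simp add: list_update_append)
  next
    case False
    then show ?thesis using assms(2) by simp
  qed
  then show ?thesis unfolding mlin_def lab_def by simp
qed

text \<open>The swap is expressed by concatenation, which fits reversed lists. It holds for every
  length, as \<open>f\<close> vanishes off length \<open>k\<close>.\<close>

lemma cochainsD:
  assumes "f \<in> cochains sG G sV k"
  shows "length xs \<noteq> k \<Longrightarrow> f xs = 0" "multilin sG sV k f"
    "homs (l @ x # y # u) (l' @ p # p' # u') \<Longrightarrow> length l = length l' \<Longrightarrow>
      f (l @ x # y # u) = - sV (par_sign (p * p')) (f (l @ y # x # u))"
proof -
  show 1: "length xs \<noteq> k \<Longrightarrow> f xs = 0" for xs
    using assms unfolding cochains_def by auto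
  show "multilin sG sV k f" using assms unfolding cochains_def by auto
  assume h: "homs (l @ x # y # u) (l' @ p # p' # u')" "length l = length l'"
  show "f (l @ x # y # u) = - sV (par_sign (p * p')) (f (l @ y # x # u))"
  proof (cases "length (l @ x # y # u) = k")
    case True
    have "f xs = - sV (par_sign (ps ! i * ps ! Suc i)) (f (xs[i := xs ! Suc i, Suc i := xs ! i]))"
      if "length xs = k" "homs xs ps" "Suc i < k" for xs ps i
      using assms that unfolding cochains_def by blast
    from this[OF True h(1), of "length l"] True h(2) show ?thesis
      by (simp add: nth_append list_update_append)
  next
    case False
    then show ?thesis using 1 by simp
  qed
qed

lemma cochainsI:
  assumes "\<And>xs. length xs \<noteq> k \<Longrightarrow> f xs = 0" "multilin sG sV k f"
    "\<And>l x y u l' p p' u'. length (l @ x # y # u) = k \<Longrightarrow> homs (l @ x # y # u) (l' @ p # p' # u') \<Longrightarrow>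
      length l = length l' \<Longrightarrow> f (l @ x # y # u) = - sV (par_sign (p * p')) (f (l @ y # x # u))"
  shows "f \<in> cochains sG G sV k"
proof -
  have "f xs = - sV (par_sign (ps ! i * ps ! Suc i)) (f (xs[i := xs ! Suc i, Suc i := xs ! i]))"
    if "length xs = k" "homs xs ps" "Suc i < k" for xs ps i
  proof -
    have split: "zs = take i zs @ zs ! i # zs ! Suc i # drop (Suc (Suc i)) zs" if "Suc i < length zs" for zs :: "'b list"
      using that by (metis Cons_nth_drop_Suc Suc_lessD id_take_nth_drop)
    define l u where "l = take i xs" and "u = drop (Suc (Suc i)) xs"
    have xs: "xs = l @ xs ! i # xs ! Suc i # u" and il: "i = length l"
      using split[of xs] that by (simp_all add: l_def u_def)
    have len: "length ps = k" using that list_all2_lengthD by metis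
    have ps: "ps = take i ps @ ps ! i # ps ! Suc i # drop (Suc (Suc i)) ps"
      using split[of ps] that len by simp
    have "xs[i := xs ! Suc i, Suc i := xs ! i] = l @ xs ! Suc i # xs ! i # u"
      by (subst xs) (simp add: il list_update_append)
    then show ?thesis
      using assms(3)[of l "xs ! i" "xs ! Suc i" u "take i ps" "ps ! i" "ps ! Suc i" "drop (Suc (Suc i)) ps"]
        that len xs ps il by (metis length_take min.absorb4 Suc_lessD)
  qed
  then show ?thesis using assms(1,2) unfolding cochains_def by blast
qed

lemma skew_lab:
  assumes "f \<in> cochains sG G sV k" shows "skew (lab f)"
proof (rule skewI)
  fix ys a b zs assume h: "\<forall>y\<in>set (ys @ a # b # zs). homog y"
  have "homs (rev (map snd zs) @ snd b # snd a # rev (map snd ys))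
      (rev (map fst zs) @ fst b # fst a # rev (map fst ys))"
    using homs_rev_unzip[OF h] by simp
  from cochainsD(3)[OF assms this]
  show "lab f (ys @ a # b # zs) = - sV (sg a b) (lab f (ys @ b # a # zs))"
    by (simp add: lab_def sg_def mult.commute)
qed

section \<open>Homogeneous components of cochains\<close>

lemma map2_proj_update:
  assumes "length ps = length xs" "i < length xs"
  shows "map2 (proj G) ps (xs[i := y]) = (map2 (proj G) ps xs)[i := proj G (ps ! i) y]"
  using assms by (intro nth_equalityI) (auto simp: nth_list_update)

lemma multilin_cochain_part:
  assumes "multilin sG sV k f" shows "multilin sG sV k (cochain_part G V q f)"
  by (rule multilinI)
    (auto simp: cochain_part_def map2_proj_update proj_add proj_scale V.proj_add V.proj_scale
       multilinD[OF assms] V.scale_sum_right sum.distrib[symmetric] intro!: sum.cong)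

text \<open>Any parity list other than \<open>ps\<close> projects some argument to 0, so a single
  summand survives.\<close>

lemma cochain_part_homs:
  assumes "multilin sG sV k f" "length xs = k" "homs xs ps"
  shows "cochain_part G V q f xs = proj V (q + sum_list ps) (f xs)"
proof -
  have len: "length ps = k" using assms list_all2_lengthD by metis
  have "proj V (q + sum_list ps') (f (map2 (proj G) ps' xs)) = (if ps' = ps then proj V (q + sum_list ps) (f xs) else 0)"
    if l: "length ps' = k" for ps'
  proof (cases "ps' = ps")
    case True then show ?thesis using map2_proj_homogeneous(2)[OF assms(3)] by simp
  next
    case False
    then obtain j where "j < k" "map2 (proj G) ps' xs ! j = 0"
      using map2_proj_homogeneous(3)[OF assms(3), of ps'] l len by auto
    then have "f (map2 (proj G) ps' xs) = 0"
      using l assms(2) by (intro multilin_zero[OF assms(1)]) auto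
    then show ?thesis using False V.proj_zero by simp
  qed
  then have "cochain_part G V q f xs =
      (\<Sum>ps' | length ps' = k. if ps' = ps then proj V (q + sum_list ps) (f xs) else 0)"
    unfolding cochain_part_def using assms(2) by (intro sum.cong) auto
  also have "\<dots> = proj V (q + sum_list ps) (f xs)"
    using finite_bit_lists len by (subst sum.delta) auto
  finally show ?thesis .
qed

lemma cochain_part_parity:
  assumes "multilin sG sV k f" shows "cochain_parity G V k q (cochain_part G V q f)"
  unfolding cochain_parity_def using cochain_part_homs[OF assms] V.proj_props by simp

lemma cochain_part_support:
  assumes "\<And>xs. length xs \<noteq> k \<Longrightarrow> f xs = 0" "length xs \<noteq> k"
  shows "cochain_part G V q f xs = 0"
  using assms by (simp add: cochain_part_def V.proj_zero)

lemma cochain_part_cochains: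
  assumes "f \<in> cochains sG G sV k" shows "cochain_part G V q f \<in> cochains sG G sV k"
proof (rule cochainsI)
  note f = cochainsD[OF assms]
  show "length xs \<noteq> k \<Longrightarrow> cochain_part G V q f xs = 0" for xs
    using cochain_part_support f(1) by blast
  show "multilin sG sV k (cochain_part G V q f)" by (rule multilin_cochain_part[OF f(2)])
  fix l x y u l' p p' u'
  assume h: "length (l @ x # y # u) = k" "homs (l @ x # y # u) (l' @ p # p' # u')" "length l = length l'"
  have h': "homs (l @ y # x # u) (l' @ p' # p # u')"
    using h(2,3) by (auto simp: list_all2_append)
  \<comment> \<open>The swap keeps the total parity, so both sides use the same projection of
    \<open>V\<close>.\<close>
  have "sum_list (l' @ p # p' # u') = sum_list (l' @ p' # p # u')" by (simp add: ac_simps)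
  moreover have "proj V t (- v) = - proj V t v" for t v
    using V.proj_scale[of t "-1" v] by simp
  ultimately show "cochain_part G V q f (l @ x # y # u)
      = - sV (par_sign (p * p')) (cochain_part G V q f (l @ y # x # u))"
    using cochain_part_homs[OF f(2) h(1,2)] cochain_part_homs[OF f(2) _ h'] f(3)[OF h(2,3)] h(1)
    by (simp add: V.proj_scale add.left_commute[of p])
qed

lemma proj_beta: "proj V p (\<beta> v) = \<beta> (proj V p v)"
proof (rule V.proj_eqI)
  show "\<beta> (proj V p v) \<in> V p" using V.proj_props beta_even by blast
  show "\<beta> v - \<beta> (proj V p v) \<in> V (p + 1)"
    using V.proj_props beta_even by (simp flip: beta_simps)
qed

lemma homs_map_alpha: "homs xs ps \<Longrightarrow> homs (map \<alpha> xs) ps"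
  by (auto simp: list_all2_conv_all_nth alpha_even)

lemma equivariant_extend:
  assumes "multilin sG sV k f" "\<And>xs ps. length xs = k \<Longrightarrow> homs xs ps \<Longrightarrow> \<beta> (f xs) = f (map \<alpha> xs)"
    "length xs = k"
  shows "\<beta> (f xs) = f (map \<alpha> xs)"
proof (rule multilin_eqI[OF _ _ assms(3), where f = "\<lambda>xs. \<beta> (f xs)" and g = "\<lambda>xs. f (map \<alpha> xs)"])
  show "multilin sG sV k (\<lambda>xs. \<beta> (f xs))" "multilin sG sV k (\<lambda>xs. f (map \<alpha> xs))"
    using multilinD[OF assms(1)] by (auto intro!: multilinI simp: beta_simps map_update alpha_simps)
qed (rule assms(2))

lemma cochain_part_hom_cochains:
  assumes "f \<in> hom_cochains sG G \<alpha> sV \<beta> k" shows "cochain_part G V q f \<in> hom_cochains sG G \<alpha> sV \<beta> k"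
proof -
  have f: "f \<in> cochains sG G sV k" "\<And>xs. length xs = k \<Longrightarrow> \<beta> (f xs) = f (map \<alpha> xs)"
    using assms by (auto simp: hom_cochains_def)
  note ml = cochainsD(2)[OF f(1)]
  have "\<beta> (cochain_part G V q f xs) = cochain_part G V q f (map \<alpha> xs)" if "length xs = k" for xs
    using multilin_cochain_part[OF ml] _ that
    by (rule equivariant_extend)
      (simp add: cochain_part_homs[OF ml _ homs_map_alpha] cochain_part_homs[OF ml] f(2)[symmetric] proj_beta)
  then show ?thesis using cochain_part_cochains[OF f(1)] by (simp add: hom_cochains_def)
qed

text \<open>At homogeneous arguments the two components are complementary projections of the same
  value; multilinearity does the rest.\<close>

lemma cochain_part_sum:
  assumes "f \<in> cochains sG G sV k" shows "cochain_part G V 0 f + cochain_part G V 1 f = f"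
proof
  note f = cochainsD[OF assms]
  fix xs
  show "(cochain_part G V 0 f + cochain_part G V 1 f) xs = f xs"
  proof (cases "length xs = k")
    case True
    show ?thesis
    proof (rule multilin_eqI[OF _ f(2) True])
      show "multilin sG sV k (cochain_part G V 0 f + cochain_part G V 1 f)"
        using multilinD[OF multilin_cochain_part[OF f(2)]]
        by (auto intro!: multilinI simp: V_simps)
      show "(cochain_part G V 0 f + cochain_part G V 1 f) xs = f xs" if "length xs = k" "homs xs ps" for xs ps
        using cochain_part_homs[OF f(2) that] V.proj_sum[of "sum_list ps"] by (simp add: add.commute)
    qed
  next
    case False then show ?thesis using f(1) cochain_part_support[of k f] by simp
  qed
qed

section \<open>The coboundary on hom-cochains\<close>

lemma delta_dop:
  assumes "f \<in> cochains sG G sV k" "cochain_parity G V k q f" "length xs = Suc k" "homs xs ps"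
  shows "delta G br \<alpha> sV V act r k f xs = sV ((-1) ^ k) (dop (k + r - 1) q (lab f) (rev (zip ps xs)))"
  using delta_eq_delta_homogeneous[OF assms(1,2) _ assms(4)] delta_homogeneous_lab[of xs k ps]
    list_all2_lengthD[OF assms(4)] assms(3) by simp

lemma delta_expand:
  assumes "length xs = Suc k"
  shows "delta G br \<alpha> sV V act r k f xs = (\<Sum>q\<in>{0, 1}. \<Sum>ps | length ps = Suc k.
      sV ((-1) ^ k) (dop (k + r - 1) q (lab (cochain_part G V q f)) (rev (zip ps (map2 (proj G) ps xs)))))"
proof -
  have "delta_homogeneous sV br \<alpha> act r k q (cochain_part G V q f) ps (map2 (proj G) ps xs)
      = sV ((-1) ^ k) (dop (k + r - 1) q (lab (cochain_part G V q f)) (rev (zip ps (map2 (proj G) ps xs))))"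
    if "length ps = Suc k" for q ps
    using assms that by (intro delta_homogeneous_lab) simp_all
  then show ?thesis unfolding delta_def using assms by simp
qed

text \<open>In \<open>delta_expand\<close> each summand is multilinear at fixed labels, composed
  with linear projections of the arguments.\<close>

lemma multilin_delta:
  assumes "f \<in> cochains sG G sV k"
  shows "multilin sG sV (Suc k) (delta G br \<alpha> sV V act r k f)"
proof (rule multilinI)
  note f = cochainsD[OF assms]
  have ml: "mlin (dop n q (lab (cochain_part G V q f)))" for n q
    using f(1) by (intro mlin_dop mlin_lab[of k] multilin_cochain_part[OF f(2)] cochain_part_support)
  fix xs :: "'g list" and i assume xs: "length xs = Suc k" "i < Suc k"
  have z: "rev (zip ps (map2 (proj G) ps (xs[i := y])))
      = rev (drop (Suc i) (zip ps (map2 (proj G) ps xs))) @ (ps ! i, proj G (ps ! i) y)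
        # rev (take i (zip ps (map2 (proj G) ps xs)))"
    if "length ps = Suc k" for ps y
  proof -
    have "zip ps (map2 (proj G) ps (xs[i := y])) = (zip ps (map2 (proj G) ps xs))[i := (ps ! i, proj G (ps ! i) y)]"
      using that xs map2_proj_update[of ps xs i y]
        zip_update[of ps i "ps ! i" "map2 (proj G) ps xs" "proj G (ps ! i) y"] by simp
    then show ?thesis using that xs by (simp add: upd_conv_take_nth_drop)
  qed
  show "delta G br \<alpha> sV V act r k f (xs[i := x + y])
      = delta G br \<alpha> sV V act r k f (xs[i := x]) + delta G br \<alpha> sV V act r k f (xs[i := y])" for x y
    using xs by (simp add: delta_expand z proj_add mlinD[OF ml] V_simps sum.distrib)
  show "delta G br \<alpha> sV V act r k f (xs[i := sG c x]) = sV c (delta G br \<alpha> sV V act r k f (xs[i := x]))" for c x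
    using xs by (simp add: delta_expand z proj_scale mlinD[OF ml] V_simps V.scale_sum_right mult.commute)
qed

lemma delta_add: "delta G br \<alpha> sV V act r k (f + g) = delta G br \<alpha> sV V act r k f + delta G br \<alpha> sV V act r k g"
proof
  have "lab (cochain_part G V q (f + g)) = (\<lambda>ys. lab (cochain_part G V q f) ys + lab (cochain_part G V q g) ys)" for q
    by (simp add: fun_eq_iff lab_def cochain_part_def V.proj_add sum.distrib)
  then show "delta G br \<alpha> sV V act r k (f + g) xs = (delta G br \<alpha> sV V act r k f + delta G br \<alpha> sV V act r k g) xs" for xs
    by (cases "length xs = Suc k")
      (simp_all add: delta_expand dop_add V_simps sum.distrib, simp add: delta_def)
qed

lemma delta_scale: "delta G br \<alpha> sV V act r k (\<lambda>xs. sV c (f xs)) xs = sV c (delta G br \<alpha> sV V act r k f xs)"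
proof -
  have "lab (cochain_part G V q (\<lambda>xs. sV c (f xs))) = (\<lambda>ys. sV c (lab (cochain_part G V q f) ys))" for q
    by (simp add: fun_eq_iff lab_def cochain_part_def V.proj_scale V.scale_sum_right)
  then show ?thesis
    by (cases "length xs = Suc k")
      (simp_all add: delta_expand dop_scale V_simps V.scale_sum_right mult.commute, simp add: delta_def)
qed

text \<open>Lists of every length are covered, as \<open>dop_dop\<close> demands: off length
  \<open>k\<close> both sides are 0.\<close>

lemma lab_equivariant:
  assumes "f \<in> hom_cochains sG G \<alpha> sV \<beta> k"
  shows "lab f (map tw ys) = \<beta> (lab f ys)"
proof (cases "length ys = k")
  case True
  then show ?thesis using assms by (simp add: hom_cochains_def lab_def rev_map o_def)
next
  case False
  then show ?thesis using assms cochainsD(1)[of f k] by (simp add: hom_cochains_def lab_def beta_simps)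
qed

lemma homs_rev_zip: "homs xs ps \<Longrightarrow> \<forall>y\<in>set (rev (zip ps xs)). homog y"
  using homs_zip by simp

text \<open>At homogeneous arguments the coboundary is a sign times \<open>dop\<close>, from which
  symmetry, parity and equivariance are inherited; equivariance then extends by
  multilinearity.\<close>

lemma delta_hom_cochains_parity:
  assumes f: "f \<in> hom_cochains sG G \<alpha> sV \<beta> k" and q: "cochain_parity G V k q f"
  shows "delta G br \<alpha> sV V act r k f \<in> hom_cochains sG G \<alpha> sV \<beta> (Suc k)"
    and "cochain_parity G V (Suc k) q (delta G br \<alpha> sV V act r k f)"
proof -
  let ?d = "delta G br \<alpha> sV V act r k f"
  have fc: "f \<in> cochains sG G sV k" using f by (simp add: hom_cochains_def)
  note D = delta_dop[OF fc q, of _ _ r]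
  have ml: "mlin (lab f)" using cochainsD[OF fc] mlin_lab by blast
  have "?d \<in> cochains sG G sV (Suc k)"
  proof (rule cochainsI)
    show "length xs \<noteq> Suc k \<Longrightarrow> ?d xs = 0" for xs by (simp add: delta_def)
    show "multilin sG sV (Suc k) ?d" by (rule multilin_delta[OF fc])
    fix l x y u l' p p' u'
    assume h: "length (l @ x # y # u) = Suc k" "homs (l @ x # y # u) (l' @ p # p' # u')" "length l = length l'"
    have h': "homs (l @ y # x # u) (l' @ p' # p # u')"
      using h(2,3) by (auto simp: list_all2_append)
    \<comment> \<open>Reversal puts \<open>y\<close> in front of \<open>x\<close>.\<close>
    show "?d (l @ x # y # u) = - sV (par_sign (p * p')) (?d (l @ y # x # u))"
      using D[OF h(1,2)] D[OF _ h'] h(1,3) homs_rev_zip[OF h(2)]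
        skewD[OF dop_skew[OF ml skew_lab[OF fc]], of "rev (zip u' u)" "(p', y)" "(p, x)" "rev (zip l' l)" "k + r - 1" q]
      by (simp add: sg_def V_simps ac_simps)
  qed
  moreover have "\<beta> (?d xs) = ?d (map \<alpha> xs)" if "length xs = Suc k" for xs
    using multilin_delta[OF fc] _ that
  proof (rule equivariant_extend)
    fix xs ps assume h: "length xs = Suc k" "homs xs ps"
    have "rev (zip ps (map \<alpha> xs)) = map tw (rev (zip ps xs))"
      by (simp add: rev_map zip_map2 tw_def case_prod_beta)
    then show "\<beta> (?d xs) = ?d (map \<alpha> xs)"
      using D[OF h] D[OF _ homs_map_alpha[OF h(2)]] h(1)
        dop_map_tw[of "lab f", OF lab_equivariant[OF f] homs_rev_zip[OF h(2)]]
      by (simp add: beta_simps)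
  qed
  ultimately show "?d \<in> hom_cochains sG G \<alpha> sV \<beta> (Suc k)" by (simp add: hom_cochains_def)
  show "cochain_parity G V (Suc k) q ?d"
    unfolding cochain_parity_def
  proof (intro allI impI)
    fix xs ps assume h: "length xs = Suc k" "homs xs ps"
    have len: "length ps = length xs" using h list_all2_lengthD by metis
    have "lab f ys \<in> V (q + par ys)" if "\<forall>y\<in>set ys. homog y" for ys
    proof (cases "length ys = k")
      case True
      have "homs (rev (map snd ys)) (rev (map fst ys))"
        using that by (rule homs_rev_unzip)
      then have "f (rev (map snd ys)) \<in> V (q + sum_list (rev (map fst ys)))"
        using q True unfolding cochain_parity_def by (metis length_map length_rev)
      then show ?thesis by (simp add: lab_def)
    next
      case False
      then show ?thesis using cochainsD(1)[OF fc] by (simp add: lab_def V.zero_part)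
    qed
    from dop_parity[OF this homs_rev_zip[OF h(2)]]
    have "dop (k + r - 1) q (lab f) (rev (zip ps xs)) \<in> V (q + sum_list ps)"
      using len by (simp add: rev_map[symmetric])
    then show "?d xs \<in> V (q + sum_list ps)"
      using D[OF h] V.subspace_part by (simp add: V.subspace_scale)
  qed
qed

text \<open>The first coboundary again has parity \<open>q\<close>, so both applications are
  described by \<open>dop\<close> with the same \<open>q\<close>, and \<open>dop_dop\<close>
  applies.\<close>

lemma delta_delta_parity:
  assumes f: "f \<in> hom_cochains sG G \<alpha> sV \<beta> k" and q: "cochain_parity G V k q f" and r: "r \<ge> 1"
  shows "delta G br \<alpha> sV V act r (Suc k) (delta G br \<alpha> sV V act r k f) = 0"
proof
  let ?d = "delta G br \<alpha> sV V act r k f"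
  have fc: "f \<in> cochains sG G sV k" using f by (simp add: hom_cochains_def)
  have ml: "mlin (lab f)" using cochainsD[OF fc] mlin_lab by blast
  note d = delta_hom_cochains_parity[OF f q, of r]
  have dc: "?d \<in> cochains sG G sV (Suc k)" using d by (simp add: hom_cochains_def)
  fix xs
  show "delta G br \<alpha> sV V act r (Suc k) ?d xs = 0 xs"
  proof (cases "length xs = Suc (Suc k)")
    case True
    show ?thesis
    proof (rule multilin_eqI[OF multilin_delta[OF dc] _ True])
      show "multilin sG sV (Suc (Suc k)) 0" by (rule multilinI) simp_all
      fix xs ps assume h: "length xs = Suc (Suc k)" "homs xs ps"
      have "lab ?d ys = sV ((-1) ^ k) (dop (k + r - 1) q (lab f) ys)"
        if "Suc (length ys) = length (rev (zip ps xs))" "\<forall>y\<in>set ys. homog y" for ys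
      proof -
        have "homs (rev (map snd ys)) (rev (map fst ys))"
          using that(2) by (rule homs_rev_unzip)
        moreover have "length (rev (map snd ys)) = Suc k"
          using that(1) h(1) list_all2_lengthD[OF h(2)] by simp
        ultimately show ?thesis
          using delta_dop[OF fc q, of "rev (map snd ys)" "rev (map fst ys)" r]
          by (simp add: lab_def zip_rev zip_map_fst_snd)
      qed
      then have "dop (Suc k + r - 1) q (lab ?d) (rev (zip ps xs))
          = dop (Suc k + r - 1) q (\<lambda>ys. sV ((-1) ^ k) (dop (k + r - 1) q (lab f) ys)) (rev (zip ps xs))"
        using homs_rev_zip[OF h(2)] by (rule dop_cong)
      also have "\<dots> = 0"
      proof -
        \<comment> \<open>Here \<open>r \<ge> 1\<close> guards the truncated subtraction, also for
          \<open>k = 0\<close>; the exponents of the two coboundaries then differ by exactly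
          one.\<close>
        have "Suc k + r - 1 = Suc (k + r - 1)" using r by simp
        then show ?thesis
          using dop_dop[OF ml lab_equivariant[OF f] homs_rev_zip[OF h(2)]] by (simp only: dop_scale V.scale_zero_right)
      qed
      finally show "delta G br \<alpha> sV V act r (Suc k) ?d xs = 0 xs"
        using delta_dop[OF dc d(2) h, of r] by simp
    qed
  next
    case False then show ?thesis by (simp add: delta_def)
  qed
qed

section \<open>The cochain complex\<close>

lemma hom_cochains_subspace:
  "module.subspace (\<lambda>c f xs. sV c (f xs)) (hom_cochains sG G \<alpha> sV \<beta> k)"
proof -
  interpret F: vector_space "\<lambda>c (f::'g list \<Rightarrow> 'v) xs. sV c (f xs)"
    by unfold_locales (auto simp: V_simps V.scale_left_distrib fun_eq_iff)
  have lin: "(0::'g list \<Rightarrow> 'v) \<in> cochains sG G sV k"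
    "f \<in> cochains sG G sV k \<Longrightarrow> g \<in> cochains sG G sV k \<Longrightarrow> f + g \<in> cochains sG G sV k"
    "f \<in> cochains sG G sV k \<Longrightarrow> (\<lambda>xs. sV c (f xs)) \<in> cochains sG G sV k" for f g c
  proof -
    show "(0::'g list \<Rightarrow> 'v) \<in> cochains sG G sV k" by (auto intro!: cochainsI multilinI)
  next
    assume f: "f \<in> cochains sG G sV k" and g: "g \<in> cochains sG G sV k"
    show "f + g \<in> cochains sG G sV k"
    proof (rule cochainsI)
      show "multilin sG sV k (f + g)"
        using multilinD[OF cochainsD(2)[OF f]] multilinD[OF cochainsD(2)[OF g]]
        by (auto intro!: multilinI simp: V_simps)
      fix l x y u l' p p' u'
      assume h: "homs (l @ x # y # u) (l' @ p # p' # u')" "length l = length l'"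
      show "(f + g) (l @ x # y # u) = - sV (par_sign (p * p')) ((f + g) (l @ y # x # u))"
        using cochainsD(3)[OF f h] cochainsD(3)[OF g h] by (simp add: V_simps)
    qed (use cochainsD(1)[OF f] cochainsD(1)[OF g] in simp)
  next
    assume f: "f \<in> cochains sG G sV k"
    show "(\<lambda>xs. sV c (f xs)) \<in> cochains sG G sV k"
    proof (rule cochainsI)
      show "multilin sG sV k (\<lambda>xs. sV c (f xs))"
        using multilinD[OF cochainsD(2)[OF f]]
        by (auto intro!: multilinI simp: V_simps ac_simps)
      fix l x y u l' p p' u'
      assume h: "homs (l @ x # y # u) (l' @ p # p' # u')" "length l = length l'"
      show "sV c (f (l @ x # y # u)) = - sV (par_sign (p * p')) (sV c (f (l @ y # x # u)))"
        using cochainsD(3)[OF f h] by (simp add: V_simps ac_simps)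
    qed (use cochainsD(1)[OF f] in simp)
  qed
  show ?thesis
    by (rule F.subspaceI) (auto simp: hom_cochains_def lin beta_simps)
qed

lemma cohomology_complex_delta:
  assumes r: "r \<ge> 1"
  shows "cohomology_complex (\<lambda>c f xs. sV c (f xs)) (hom_cochains sG G \<alpha> sV \<beta>) (delta G br \<alpha> sV V act r)"
proof -
  let ?d = "delta G br \<alpha> sV V act r" and ?C = "hom_cochains sG G \<alpha> sV \<beta>"
  interpret F: vector_space "\<lambda>c (f::'g list \<Rightarrow> 'v) xs. sV c (f xs)"
    by unfold_locales (auto simp: V_simps V.scale_left_distrib fun_eq_iff)
  \<comment> \<open>The witnesses are the even and odd components given by
    \<open>cochain_part\<close>; additivity of \<open>delta\<close> reduces both claims to
    them.\<close>
  have split: "\<exists>f0 f1. f = f0 + f1 \<and> f0 \<in> ?C k \<and> f1 \<in> ?C k \<and> cochain_parity G V k 0 f0 \<and> cochain_parity G V k 1 f1"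
    if "f \<in> ?C k" for f k
    using that cochain_part_hom_cochains[OF that] cochain_part_parity[OF cochainsD(2)] cochain_part_sum
    unfolding hom_cochains_def by (metis (mono_tags, lifting) mem_Collect_eq)
  have "?d k f \<in> ?C (Suc k) \<and> ?d (Suc k) (?d k f) = 0" if "f \<in> ?C k" for f k
  proof -
    note split = split[OF that]
    obtain f0 f1 where f: "f = f0 + f1" "f0 \<in> ?C k" "f1 \<in> ?C k"
      "cochain_parity G V k 0 f0" "cochain_parity G V k 1 f1"
      using split by blast
    have "?d k f0 + ?d k f1 \<in> ?C (Suc k)"
      using f by (intro F.subspace_add[OF hom_cochains_subspace] delta_hom_cochains_parity(1))
    then show ?thesis
      using delta_delta_parity[OF f(2,4) r] delta_delta_parity[OF f(3,5) r] by (simp add: f(1) delta_add)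
  qed
  then have "?d k f \<in> ?C (Suc k)" "?d (Suc k) (?d k f) = 0" if "f \<in> ?C k" for f k
    using that by blast+
  moreover from this(2) have "?d k (?d (k - 1) f) = 0" if "k > 1" "f \<in> ?C (k - 1)" for f k
    using that by (cases k) auto
  ultimately show ?thesis
    unfolding cohomology_complex_def Suc_eq_plus1[symmetric]
    using hom_cochains_subspace F.vector_space_axioms
    by (intro conjI allI impI ballI delta_add ext[OF delta_scale]) blast+
qed

end

theorem theorem3p6:
  fixes sG :: "'k::field \<Rightarrow> 'g::ab_group_add \<Rightarrow> 'g" and G :: "bit \<Rightarrow> 'g set"
    and br :: "'g \<Rightarrow> 'g \<Rightarrow> 'g" and \<alpha> :: "'g \<Rightarrow> 'g"
    and sV :: "'k \<Rightarrow> 'v::ab_group_add \<Rightarrow> 'v" and V :: "bit \<Rightarrow> 'v set"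
    and act :: "'g \<Rightarrow> 'v \<Rightarrow> 'v" and \<beta> :: "'v \<Rightarrow> 'v" and r :: nat
  assumes "multiplicative_hom_lie_superalgebra sG G br \<alpha>"
    and "hom_module sG G br \<alpha> sV V act \<beta>"
    and "r \<ge> 1"
  shows "cohomology_complex (\<lambda>c f xs. sV c (f xs))
           (hom_cochains sG G \<alpha> sV \<beta>)
           (delta G br \<alpha> sV V act r)"
proof -
  interpret multiplicative_hom_module sG G br \<alpha> sV V act \<beta>
    using assms(1,2) by (rule multiplicative_hom_module.intro)
  show ?thesis using assms(3) by (rule cohomology_complex_delta)
qed

end
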